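(* Let the sequence $\{q_k:k\in\mathbb N\}$ be non-decreasing. Then the maximal operator $$\widetilde t_{1}^{\,*}f:=\sup_{n\in\mathbb N_+}\frac{|t_nf|}{\log^2(n+1)}$$ is bounded from the Hardy space $H_{1/2}$ to the Lebesgue space $L_{1/2}$.
   Context: $\mathbb N_+$ is the set of positive integers, $\mathbb N=\mathbb N_+\cup\{0\}$. Fix a bounded sequence $m=(m_0,m_1,\dots)$ of integers $m_k\ge 2$. $G_m=\prod_{k\ge0}Z_{m_k}$, where $Z_{m_k}=\{0,\dots,m_k-1\}$ is the additive group modulo $m_k$, with the product of the discrete topologies; $\mu$ is the Haar measure with $\mu(G_m)=1$. $M_0:=1$, $M_{k+1}:=m_kM_k$; every $n\in\mathbb N$ is uniquely $n=\sum_{j\ge0}n_jM_j$ with $n_j\in Z_{m_j}$. $r_k(x):=\exp(2\pi i x_k/m_k)$, $\psi_n:=\prod_{k\ge0}r_k^{n_k}$ (Vilenkin system). $I_0(x):=G_m$, $I_n(x):=\{y: y_0=x_0,\dots,y_{n-1}=x_{n-1}\}$; $\mathcal F_n$ is the $\sigma$-algebra generated by $\{I_n(x):x\in G_m\}$. For $g\in L_1(G_m)$: $\widehat g(k):=\int g\overline{\psi_k}\,d\mu$, $S_ng:=\sum_{k=0}^{n-1}\widehat g(k)\psi_k$. A martingale is a sequence $f=(f^{(n)}:n\in\mathbb N)$ of integrable functions with $f^{(n)}$ $\mathcal F_n$-measurable and $S_{M_n}f^{(k)}=f^{(n)}$ for $n\le k$; $f^*:=\sup_n|f^{(n)}|$;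 $H_p$ is the set of martingales with $\|f\|_{H_p}:=\|f^*\|_p<\infty$, where $\|g\|_p:=(\int|g|^pd\mu)^{1/p}$. For a martingale, $\widehat f(i):=\lim_k\int f^{(k)}\overline{\psi_i}\,d\mu$ and $S_nf:=\sum_{k=0}^{n-1}\widehat f(k)\psi_k$. For a sequence $\{q_k:k\in\mathbb N\}$ of nonnegative numbers, $Q_n:=\sum_{k=0}^{n-1}q_k$ and the Nörlund means are $t_nf:=\frac1{Q_n}\sum_{k=1}^nq_{n-k}S_kf$ ($n\in\mathbb N_+$); it is always assumed that $q_0>0$ and $Q_n\to\infty$. An operator $T$ is bounded from $H_p$ to $L_p$ if there is a constant $C$ with $\|Tf\|_p\le C\|f\|_{H_p}$ for all $f\in H_p$. *)

theory Defs
  imports "HOL-Probability.Probability"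
begin

definition vilenkin_group :: "(nat \<Rightarrow> nat) \<Rightarrow> (nat \<Rightarrow> nat) set" where
  "vilenkin_group m = (\<Pi>\<^sub>E k\<in>UNIV. {..<m k})"

text \<open>
  The normalised Haar measure is the product of the uniform probability measures on the finite
  cyclic groups. The lemmas \<open>sets_haar_eq_borel\<close>, \<open>prob_space_haar\<close> and
  \<open>haar_translation_invariant\<close> below show that it is indeed a translation invariant
  probability measure on the Borel sets of the product topology.
\<close>

definition haar :: "(nat \<Rightarrow> nat) \<Rightarrow> (nat \<Rightarrow> nat) measure" where
  "haar m = (\<Pi>\<^sub>M k\<in>UNIV. uniform_count_measure {..<m k})"

primrec gen_power :: "(nat \<Rightarrow> nat) \<Rightarrow> nat \<Rightarrow> nat" where
  "gen_power m 0 = 1"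
| "gen_power m (Suc k) = m k * gen_power m k"

text \<open>
  The coefficients of the expansion of a natural number with respect to the generalised powers;
  see \<open>digit_less\<close>, \<open>digit_expansion\<close> and \<open>digit_unique\<close> below.
\<close>

definition digit :: "(nat \<Rightarrow> nat) \<Rightarrow> nat \<Rightarrow> nat \<Rightarrow> nat" where
  "digit m n j = (n div gen_power m j) mod m j"

definition rademacher :: "(nat \<Rightarrow> nat) \<Rightarrow> nat \<Rightarrow> (nat \<Rightarrow> nat) \<Rightarrow> complex" where
  "rademacher m k x = exp (2 * of_real pi * \<i> * of_nat (x k) / of_nat (m k))"

text \<open>
  The infinite product has only finitely many factors different from 1; see
  \<open>vilenkin_eq_finite_prod\<close> below.
\<close>

definition vilenkin :: "(nat \<Rightarrow> nat) \<Rightarrow> nat \<Rightarrow> (nat \<Rightarrow> nat) \<Rightarrow> complex" where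
  "vilenkin m n x = (\<Prod>k. rademacher m k x ^ digit m n k)"

definition cylinder :: "(nat \<Rightarrow> nat) \<Rightarrow> nat \<Rightarrow> (nat \<Rightarrow> nat) \<Rightarrow> (nat \<Rightarrow> nat) set" where
  "cylinder m n x = {y \<in> vilenkin_group m. \<forall>j<n. y j = x j}"

definition cylinder_algebra :: "(nat \<Rightarrow> nat) \<Rightarrow> nat \<Rightarrow> (nat \<Rightarrow> nat) measure" where
  "cylinder_algebra m n = sigma (vilenkin_group m) (cylinder m n ` vilenkin_group m)"

definition fourier_coeff :: "(nat \<Rightarrow> nat) \<Rightarrow> ((nat \<Rightarrow> nat) \<Rightarrow> complex) \<Rightarrow> nat \<Rightarrow> complex" where
  "fourier_coeff m g k = (\<integral>x. g x * cnj (vilenkin m k x) \<partial>haar m)"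

definition partial_sum ::
  "(nat \<Rightarrow> nat) \<Rightarrow> nat \<Rightarrow> ((nat \<Rightarrow> nat) \<Rightarrow> complex) \<Rightarrow> (nat \<Rightarrow> nat) \<Rightarrow> complex" where
  "partial_sum m n g x = (\<Sum>k<n. fourier_coeff m g k * vilenkin m k x)"

text \<open>
  The martingale identity may be required pointwise: functions measurable with respect to a
  cylinder algebra are constant on cylinders, which have positive measure, so such functions agree
  almost everywhere only if they agree everywhere on the group.
\<close>

definition vilenkin_martingale ::
  "(nat \<Rightarrow> nat) \<Rightarrow> (nat \<Rightarrow> (nat \<Rightarrow> nat) \<Rightarrow> complex) \<Rightarrow> bool" where
  "vilenkin_martingale m f \<longleftrightarrow>
     (\<forall>n. integrable (haar m) (f n)) \<and>
     (\<forall>n. f n \<in> borel_measurable (cylinder_algebra m n)) \<and>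
     (\<forall>n k. n \<le> k \<longrightarrow>
        (\<forall>x\<in>vilenkin_group m. partial_sum m (gen_power m n) (f k) x = f n x))"

definition martingale_max ::
  "(nat \<Rightarrow> (nat \<Rightarrow> nat) \<Rightarrow> complex) \<Rightarrow> (nat \<Rightarrow> nat) \<Rightarrow> ennreal" where
  "martingale_max f x = (SUP n. ennreal (norm (f n x)))"

text \<open>
  Only meant for positive exponents: infinity is always mapped to infinity.
\<close>

definition ennreal_powr :: "ennreal \<Rightarrow> real \<Rightarrow> ennreal" where
  "ennreal_powr a p = (if a = \<infinity> then \<infinity> else ennreal (enn2real a powr p))"

definition Lp_quasinorm ::
  "(nat \<Rightarrow> nat) \<Rightarrow> real \<Rightarrow> ((nat \<Rightarrow> nat) \<Rightarrow> ennreal) \<Rightarrow> ennreal" where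
  "Lp_quasinorm m p g = ennreal_powr (\<integral>\<^sup>+ x. ennreal_powr (g x) p \<partial>haar m) (1 / p)"

definition hardy_quasinorm ::
  "(nat \<Rightarrow> nat) \<Rightarrow> real \<Rightarrow> (nat \<Rightarrow> (nat \<Rightarrow> nat) \<Rightarrow> complex) \<Rightarrow> ennreal" where
  "hardy_quasinorm m p f = Lp_quasinorm m p (martingale_max f)"

definition hardy_space ::
  "(nat \<Rightarrow> nat) \<Rightarrow> real \<Rightarrow> (nat \<Rightarrow> (nat \<Rightarrow> nat) \<Rightarrow> complex) set" where
  "hardy_space m p = {f. vilenkin_martingale m f \<and> hardy_quasinorm m p f < \<infinity>}"

definition bounded_hardy_to_Lp ::
  "(nat \<Rightarrow> nat) \<Rightarrow> real \<Rightarrow>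
   ((nat \<Rightarrow> (nat \<Rightarrow> nat) \<Rightarrow> complex) \<Rightarrow> (nat \<Rightarrow> nat) \<Rightarrow> ennreal) \<Rightarrow> bool" where
  "bounded_hardy_to_Lp m p T \<longleftrightarrow>
     (\<exists>C::real. 0 \<le> C \<and>
        (\<forall>f\<in>hardy_space m p. Lp_quasinorm m p (T f) \<le> ennreal C * hardy_quasinorm m p f))"

definition martingale_fourier_coeff ::
  "(nat \<Rightarrow> nat) \<Rightarrow> (nat \<Rightarrow> (nat \<Rightarrow> nat) \<Rightarrow> complex) \<Rightarrow> nat \<Rightarrow> complex" where
  "martingale_fourier_coeff m f i = lim (\<lambda>k. fourier_coeff m (f k) i)"

definition martingale_partial_sum ::
  "(nat \<Rightarrow> nat) \<Rightarrow> nat \<Rightarrow> (nat \<Rightarrow> (nat \<Rightarrow> nat) \<Rightarrow> complex) \<Rightarrow> (nat \<Rightarrow> nat) \<Rightarrow> complex" where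
  "martingale_partial_sum m n f x = (\<Sum>k<n. martingale_fourier_coeff m f k * vilenkin m k x)"

definition weight_sum :: "(nat \<Rightarrow> real) \<Rightarrow> nat \<Rightarrow> real" where
  "weight_sum q n = (\<Sum>k<n. q k)"

definition noerlund_mean ::
  "(nat \<Rightarrow> nat) \<Rightarrow> (nat \<Rightarrow> real) \<Rightarrow> nat \<Rightarrow> (nat \<Rightarrow> (nat \<Rightarrow> nat) \<Rightarrow> complex) \<Rightarrow>
   (nat \<Rightarrow> nat) \<Rightarrow> complex" where
  "noerlund_mean m q n f x =
     (1 / of_real (weight_sum q n)) *
     (\<Sum>k=1..n. of_real (q (n - k)) * martingale_partial_sum m k f x)"

definition log_maximal_noerlund ::
  "(nat \<Rightarrow> nat) \<Rightarrow> (nat \<Rightarrow> real) \<Rightarrow> (nat \<Rightarrow> (nat \<Rightarrow> nat) \<Rightarrow> complex) \<Rightarrow>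
   (nat \<Rightarrow> nat) \<Rightarrow> ennreal" where
  "log_maximal_noerlund m q f x =
     (SUP n\<in>{1..}. ennreal (norm (noerlund_mean m q n f x) / (ln (real n + 1))\<^sup>2))"

lemma gen_power_pos:
  assumes "\<And>k. 2 \<le> m k" shows "0 < gen_power m k"
proof (induction k)
  case (Suc k)
  then show ?case using assms[of k] by simp
qed simp

lemma less_gen_power:
  assumes "\<And>k. 2 \<le> m k" shows "k < gen_power m k"
proof (induction k)
  case (Suc k)
  have "Suc k < 2 * gen_power m k" using Suc by simp
  also have "\<dots> \<le> m k * gen_power m k" using assms[of k] by (intro mult_right_mono) auto
  finally have "Suc k < m k * gen_power m k" .
  then show ?case by simp
qed simp

lemma digit_less:
  assumes "\<And>k. 2 \<le> m k" shows "digit m n j < m j"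
  using assms[of j] by (simp add: digit_def)

lemma sum_digit_mod: "(\<Sum>j<k. digit m n j * gen_power m j) = n mod gen_power m k"
proof (induction k)
  case (Suc k)
  have "n mod gen_power m (Suc k) = n mod (gen_power m k * m k)"
    by (simp add: mult.commute)
  also have "\<dots> = gen_power m k * digit m n k + n mod gen_power m k"
    by (simp add: digit_def mod_mult2_eq)
  finally show ?case using Suc by simp
qed simp

lemma digit_expansion:
  assumes "n < gen_power m k"
  shows "n = (\<Sum>j<k. digit m n j * gen_power m j)"
  using assms by (simp add: sum_digit_mod)

lemma digit_eq_0:
  assumes "\<And>k. 2 \<le> m k" and "n \<le> j"
  shows "digit m n j = 0"
  using less_gen_power[of m j] assms by (simp add: digit_def)

lemma digit_unique:
  assumes m: "\<And>k. 2 \<le> m k" and d: "\<And>j. d j < m j"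
    and n: "n = (\<Sum>j<k. d j * gen_power m j)" and "j < k"
  shows "digit m n j = d j"
proof -
  have less: "(\<Sum>j<l. d j * gen_power m j) < gen_power m l" for l
  proof (induction l)
    case (Suc l)
    have "Suc (d l) * gen_power m l \<le> m l * gen_power m l"
      by (intro mult_right_mono) (use d[of l] in auto)
    with Suc show ?case by simp
  qed simp
  have "n mod gen_power m l = (\<Sum>j<l. d j * gen_power m j)" if "l \<le> k" for l
  proof -
    have dvd: "gen_power m l dvd gen_power m i" if "l \<le> i" for i
      using that by (induction i rule: dec_induct) auto
    have "{..<k} = {..<l} \<union> {l..<k}" using that by auto
    then have "n = (\<Sum>j<l. d j * gen_power m j) + (\<Sum>j=l..<k. d j * gen_power m j)"
      unfolding n by (simp add: sum.union_disjoint ivl_disj_int)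
    moreover have "gen_power m l dvd (\<Sum>j=l..<k. d j * gen_power m j)"
      by (intro dvd_sum dvd_mult dvd) auto
    ultimately show ?thesis using less[of l] by (auto elim!: dvdE)
  qed
  from this[of "Suc j"] this[of j] \<open>j < k\<close>
  have "n mod gen_power m (Suc j) = n mod gen_power m j + d j * gen_power m j" by simp
  moreover have "n mod gen_power m (Suc j) = n mod gen_power m j + digit m n j * gen_power m j"
    using sum_digit_mod[of m n "Suc j"] sum_digit_mod[of m n j] by simp
  ultimately show ?thesis using gen_power_pos[of m j] m by simp
qed

lemma vilenkin_eq_finite_prod:
  assumes "\<And>k. 2 \<le> m k"
  shows "vilenkin m n x = (\<Prod>k<n. rademacher m k x ^ digit m n k)"
  unfolding vilenkin_def using assms by (intro prodinf_finite) (auto simp: digit_eq_0)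

lemma space_haar: "space (haar m) = vilenkin_group m"
  by (simp add: haar_def vilenkin_group_def space_PiM space_uniform_count_measure)

lemma product_prob_space_uniform:
  fixes m :: "nat \<Rightarrow> nat"
  assumes "\<And>k. 2 \<le> m k"
  shows "product_prob_space (\<lambda>k. uniform_count_measure {..<m k})"
proof -
  have "prob_space (uniform_count_measure {..<m k})" for k
    using assms[of k] by (intro prob_space_uniform_count_measure) (auto simp: lessThan_empty_iff)
  then show ?thesis
    by (simp add: product_prob_space_def product_prob_space_axioms_def product_sigma_finite_def
        prob_space_imp_sigma_finite)
qed

lemma prob_space_haar:
  assumes "\<And>k. 2 \<le> m k" shows "prob_space (haar m)"
proof -
  interpret product_prob_space "\<lambda>k. uniform_count_measure {..<m k}" UNIV
    by (rule product_prob_space_uniform[OF assms])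
  show ?thesis unfolding haar_def by (rule P.prob_space_axioms)
qed

text \<open>The group operation is addition modulo \<open>m k\<close> in the coordinate \<open>k\<close>.\<close>

lemma haar_translation_invariant:
  assumes m: "\<And>k. 2 \<le> m k" and a: "a \<in> vilenkin_group m"
  shows "distr (haar m) (haar m) (\<lambda>x k. (x k + a k) mod m k) = haar m"
proof -
  let ?U = "\<lambda>k. uniform_count_measure {..<m k}"
  let ?t = "\<lambda>k i. (i + a k) mod m k"
  let ?T = "\<lambda>x k. ?t k (x k)"
  interpret product_prob_space ?U UNIV by (rule product_prob_space_uniform[OF m])
  have m0: "0 < m k" for k using m[of k] by simp
  have bij: "bij_betw (?t k) {..<m k} {..<m k}" for k
  proof -
    have "inj_on (?t k) {..<m k}"
    proof (rule inj_onI)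
      have le: "j \<le> i" if "j < m k" "?t k i = ?t k j" for i j
      proof (rule ccontr)
        assume "\<not> j \<le> i"
        then have "m k dvd (j + a k) - (i + a k)"
          using that by (subst mod_eq_dvd_iff_nat[symmetric]) auto
        with \<open>\<not> j \<le> i\<close> that show False by (auto dest: dvd_imp_le)
      qed
      fix i j assume "i \<in> {..<m k}" "j \<in> {..<m k}" "?t k i = ?t k j"
      then show "i = j" using le[of i j] le[of j i] by (intro antisym) auto
    qed
    moreover have "?t k ` {..<m k} \<subseteq> {..<m k}" using m0 by auto
    ultimately show ?thesis by (simp add: bij_betw_def endo_inj_surj)
  qed
  have meas: "?T \<in> measurable (haar m) (haar m)"
    unfolding haar_def
  proof (rule measurable_PiM_single')
    fix k
    have "?t k \<in> measurable (?U k) (?U k)"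
      using m0[of k] by (auto simp: measurable_def space_uniform_count_measure sets_uniform_count_measure)
    then show "(\<lambda>x. ?t k (x k)) \<in> measurable (PiM UNIV ?U) (?U k)"
      by measurable
  qed (use m0 in \<open>auto simp: space_PiM space_uniform_count_measure\<close>)
  show ?thesis
    unfolding haar_def
  proof (rule PiM_eq)
    fix J :: "nat set" and F assume J: "finite J" and F: "\<And>j. j \<in> J \<Longrightarrow> F j \<in> sets (?U j)"
    let ?F = "\<lambda>j. ?t j -` F j \<inter> {..<m j}"
    have F': "F j \<subseteq> {..<m j}" if "j \<in> J" for j
      using F[OF that] by (simp add: sets_uniform_count_measure)
    have "emeasure (distr (PiM UNIV ?U) (PiM UNIV ?U) ?T) (prod_emb UNIV ?U J (Pi\<^sub>E J F)) =
      emeasure (PiM UNIV ?U) (?T -` prod_emb UNIV ?U J (Pi\<^sub>E J F) \<inter> space (PiM UNIV ?U))"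
      using meas J F by (intro emeasure_distr) (auto simp: haar_def intro: sets_PiM_I)
    also have "?T -` prod_emb UNIV ?U J (Pi\<^sub>E J F) \<inter> space (PiM UNIV ?U) =
      prod_emb UNIV ?U J (Pi\<^sub>E J ?F)"
      using m0 by (auto simp: prod_emb_def space_PiM space_uniform_count_measure PiE_iff)
    also have "emeasure (PiM UNIV ?U) \<dots> = (\<Prod>j\<in>J. emeasure (?U j) (?F j))"
      using J by (intro emeasure_PiM_emb) (auto simp: sets_uniform_count_measure)
    also have "\<dots> = (\<Prod>j\<in>J. emeasure (?U j) (F j))"
    proof (rule prod.cong[OF refl])
      fix j assume j: "j \<in> J"
      have "?t j ` ?F j = F j"
      proof (intro equalityI subsetI)
        fix i assume i: "i \<in> F j"
        then have "i \<in> ?t j ` {..<m j}" using bij[of j] F'[OF j] by (auto simp: bij_betw_def)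
        then obtain l where "l \<in> {..<m j}" "i = ?t j l" by (rule imageE)
        with i show "i \<in> ?t j ` ?F j" by (intro image_eqI[of _ _ l]) auto
      qed auto
      moreover have "inj_on (?t j) (?F j)"
        using bij[of j] by (auto simp: bij_betw_def intro: inj_on_subset)
      ultimately have "card (?F j) = card (F j)"
        by (metis card_image)
      then show "emeasure (?U j) (?F j) = emeasure (?U j) (F j)"
        using F'[OF j] by (simp add: emeasure_uniform_count_measure)
    qed
    finally show "emeasure (distr (PiM UNIV ?U) (PiM UNIV ?U) ?T) (prod_emb UNIV ?U J (Pi\<^sub>E J F)) =
      (\<Prod>j\<in>J. emeasure (?U j) (F j))" .
  qed simp
qed

lemma sets_haar_eq_borel:
  "sets (haar m) = sigma_sets (vilenkin_group m)
     {U. openin (product_topology (\<lambda>k. discrete_topology {..<m k}) UNIV) U}"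
proof
  let ?X = "product_topology (\<lambda>k. discrete_topology {..<m k}) (UNIV :: nat set)"
  let ?U = "\<lambda>k. uniform_count_measure {..<m k}"
  have top: "topspace ?X = vilenkin_group m" by (simp add: vilenkin_group_def)
  have single: "sets (haar m) = sigma_sets (vilenkin_group m)
      {{f \<in> \<Pi>\<^sub>E i\<in>UNIV. {..<m i}. f i \<in> A} |i A. A \<in> Pow {..<m i}}"
    by (simp add: haar_def sets_PiM_single vilenkin_group_def space_uniform_count_measure
        sets_uniform_count_measure)
  show "sets (haar m) \<subseteq> sigma_sets (vilenkin_group m) {U. openin ?X U}"
    unfolding single
  proof (rule sigma_sets_mono', clarify)
    fix i A assume "A \<subseteq> {..<m i}"
    then have "openin ?X {f \<in> topspace ?X. f i \<in> A}"
      by (intro openin_continuous_map_preimage[OF continuous_map_product_projection]) auto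
    then show "openin ?X {f \<in> \<Pi>\<^sub>E i\<in>UNIV. {..<m i}. f i \<in> A}" by simp
  qed
  have cyl: "cylinder m n x \<in> sets (haar m)" for n x
  proof -
    have "cylinder m n x = {y \<in> space (haar m). \<forall>j\<in>{..<n}. y j \<in> {x j} \<inter> {..<m j}}"
      by (auto simp: cylinder_def space_haar vilenkin_group_def)
    also have "\<dots> \<in> sets (haar m)"
      unfolding haar_def
      by (intro sets.sets_Collect_finite_All sets_Collect_single)
        (auto simp: sets_uniform_count_measure)
    finally show ?thesis .
  qed
  have count: "countable (range (cylinder m n))" for n
  proof (rule countable_subset)
    show "range (cylinder m n) \<subseteq> range (\<lambda>l. cylinder m n (nth l))"
    proof clarify
      fix x
      have "cylinder m n x = cylinder m n (nth (map x [0..<n]))"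
        by (auto simp: cylinder_def)
      then show "cylinder m n x \<in> range (\<lambda>l. cylinder m n (nth l))" by blast
    qed
  qed simp
  show "sigma_sets (vilenkin_group m) {U. openin ?X U} \<subseteq> sets (haar m)"
  proof -
    have "U \<in> sets (haar m)" if U: "openin ?X U" for U
    proof -
      have nbhd: "\<exists>n. cylinder m n x \<subseteq> U" if "x \<in> U" for x
      proof -
        from U \<open>x \<in> U\<close> obtain V where V: "finite {i. V i \<noteq> {..<m i}}" "x \<in> Pi\<^sub>E UNIV V" "Pi\<^sub>E UNIV V \<subseteq> U"
          unfolding openin_product_topology_alt by auto
        obtain n where "{i. V i \<noteq> {..<m i}} \<subseteq> {..<n}"
          using V(1) finite_nat_iff_bounded by blast
        then have V': "V i = {..<m i}" if "\<not> i < n" for i using that by auto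
        have "y i \<in> V i" if "y \<in> cylinder m n x" for y i
        proof (cases "i < n")
          case True
          then show ?thesis using that V(2) by (auto simp: cylinder_def)
        next
          case False
          then show ?thesis using that V'[OF False] by (auto simp: cylinder_def vilenkin_group_def)
        qed
        then have "cylinder m n x \<subseteq> Pi\<^sub>E UNIV V" by (auto simp: PiE_iff)
        with V show ?thesis by blast
      qed
      have "U = \<Union>{B \<in> (\<Union>n. range (cylinder m n)). B \<subseteq> U}"
      proof (intro equalityI subsetI)
        fix x assume "x \<in> U"
        then obtain n where "cylinder m n x \<subseteq> U" using nbhd by auto
        moreover have "x \<in> cylinder m n x"
          using \<open>x \<in> U\<close> openin_subset[OF U] unfolding top by (auto simp: cylinder_def)
        ultimately show "x \<in> \<Union>{B \<in> (\<Union>n. range (cylinder m n)). B \<subseteq> U}"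
          by (intro UnionI[of "cylinder m n x"]) auto
      qed auto
      moreover have "countable {B \<in> (\<Union>n. range (cylinder m n)). B \<subseteq> U}"
        by (rule countable_subset[of _ "\<Union>n. range (cylinder m n)"]) (auto intro: count)
      then have "\<Union>{B \<in> (\<Union>n. range (cylinder m n)). B \<subseteq> U} \<in> sets (haar m)"
        by (intro sets.countable_Union) (auto intro: cyl)
      ultimately show ?thesis by simp
    qed
    then show ?thesis
      using sets.sigma_sets_subset[of "{U. openin ?X U}" "haar m"] by (auto simp: space_haar)
  qed
qed

end

theory Submission
  imports Defs
begin

text \<open>
  Summation by parts exhibits the Noerlund means of a non-decreasing sequence as convex combinations
  of Fejer means, so it suffices to bound the Fejer means with the weight \<open>ln\<^sup>2 (n + 1)\<close>.

  Since \<open>t\<^sub>n f\<close> with \<open>n \<le> M\<^sub>L\<close> only involves \<open>f\<^sup>(\<^sup>L\<^sup>)\<close>, one can work on the finite quotient of the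
  group by the cylinder of level \<open>L\<close>; its points are coded by the numbers below \<open>M\<^sub>L\<close>, so that cylinders
  of level \<open>N\<close> become residue classes modulo \<open>M\<^sub>N\<close>. The bounds obtained do not depend on \<open>L\<close>, and
  monotone convergence gives the result.

  If two points differ in the digit \<open>k\<close>, the characters cancel over every full block of \<open>M\<^bsub>k+1\<^esub>\<close> indices,
  and the Dirichlet kernel is at most \<open>M\<^bsub>k+1\<^esub>\<close>. If they also differ in a digit \<open>l > k\<close>, the Dirichlet
  kernels in turn cancel over blocks of \<open>M\<^bsub>l+1\<^esub>\<close> indices, and \<open>n K\<^sub>n\<close> is at most \<open>M\<^bsub>k+1\<^esub> M\<^bsub>l+1\<^esub>\<close> for all
  \<open>n\<close>. For an atom on a cylinder of level \<open>N\<close> only \<open>n > M\<^sub>N\<close> matters; summing the square roots of these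
  bounds over \<open>k < l < N\<close> loses a factor \<open>N\<close>, which the weight compensates. A decomposition into atoms
  by stopping times at the levels \<open>4\<^sup>i \<lambda>\<close> concludes.
\<close>

section \<open>Block sums, square roots, dyadic sums and summation by parts\<close>

lemma sum_lessThan_add:
  fixes f :: "nat \<Rightarrow> 'a::comm_monoid_add"
  shows "(\<Sum>k<a + b. f k) = (\<Sum>k<a. f k) + (\<Sum>k<b. f (a + k))"
  by (induction b) (auto simp: add.assoc)

lemma sum_block:
  fixes f :: "nat \<Rightarrow> 'a::comm_monoid_add"
  shows "(\<Sum>j<c * b. f j) = (\<Sum>d<c. \<Sum>r<b. f (d * b + r))"
  by (induction c) (auto simp: sum_lessThan_add add.commute[of b])

lemma sqrt_add_le: "0 \<le> x \<Longrightarrow> 0 \<le> y \<Longrightarrow> sqrt (x + y) \<le> sqrt x + sqrt y"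
  by (rule real_le_lsqrt) (auto simp: power2_sum)

lemma sqrt_sum_le:
  assumes "\<And>i. i \<in> I \<Longrightarrow> 0 \<le> f i" shows "sqrt (\<Sum>i\<in>I. f i) \<le> (\<Sum>i\<in>I. sqrt (f i))"
  using assms
proof (induction I rule: infinite_finite_induct)
  case (insert i I)
  then show ?case
    using sqrt_add_le[of "f i" "sum f I"] by (simp add: sum_nonneg)
qed auto

text \<open>The surviving terms form a geometric progression, so they sum to at most twice the
  largest, which is below \<open>r\<close>. With \<open>s\<close> and \<open>r\<close> square roots,
  this turns a sum over the levels \<open>4 ^ i * lam\<close> back into the root of the maximal
  function.\<close>

lemma sum_dyadic_le:
  assumes "0 \<le> s" "0 \<le> (r::real)"
  shows "(\<Sum>i<n. 2 ^ i * s * of_bool (2 ^ i * s < r)) \<le> 2 * r"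
proof (induction n)
  case (Suc n)
  show ?case
  proof (cases "2 ^ n * s < r")
    case True
    have "(\<Sum>i<Suc n. 2 ^ i * s * of_bool (2 ^ i * s < r)) \<le> (\<Sum>i<Suc n. 2 ^ i * s)"
      using assms by (intro sum_mono) auto
    also have "\<dots> = (2 ^ Suc n - 1) * s"
      unfolding sum_distrib_right[symmetric] by (subst sum_gp_strict) simp
    also have "\<dots> \<le> 2 * (2 ^ n * s)" using assms by (simp add: algebra_simps)
    finally show ?thesis using True by linarith
  next
    case False
    then show ?thesis using Suc by simp
  qed
qed (use assms in simp)

text \<open>Summation by parts, one step at a time: splitting the constant \<open>q 0\<close> off
  all weights leaves a full partial sum, bounded by hypothesis, and a shorter sum whose weights
  \<open>q'\<close> are again non-negative and non-decreasing. The bounds add up exactly to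
  \<open>B\<close> times the total weight.\<close>

lemma norm_noerlund_sum_le:
  fixes S :: "nat \<Rightarrow> complex" and q :: "nat \<Rightarrow> real"
  assumes "mono q" "0 \<le> q 0" "0 \<le> B"
    and "\<And>j. 1 \<le> j \<Longrightarrow> j \<le> n \<Longrightarrow> norm (\<Sum>k=1..j. S k) \<le> real j * B"
  shows "norm (\<Sum>k=1..n. of_real (q (n - k)) * S k) \<le> B * (\<Sum>k<n. q k)"
  using assms
proof (induction n arbitrary: q)
  case (Suc n)
  define q' where "q' i = q (Suc i) - q 0" for i
  have q': "mono q'" "0 \<le> q' 0"
    using Suc.prems(1) by (auto simp: q'_def mono_def)
  have "(\<Sum>k=1..Suc n. of_real (q (Suc n - k)) * S k) =
      of_real (q 0) * (\<Sum>k=1..Suc n. S k) + (\<Sum>k=1..n. of_real (q' (n - k)) * S k)"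
  proof -
    have "of_real (q (Suc n - k)) * S k = of_real (q 0) * S k + of_real (q' (n - k)) * S k"
      if "k \<in> {1..n}" for k
      using that by (simp add: q'_def Suc_diff_le algebra_simps)
    then have "(\<Sum>k=1..n. of_real (q (Suc n - k)) * S k) =
        (\<Sum>k=1..n. of_real (q 0) * S k) + (\<Sum>k=1..n. of_real (q' (n - k)) * S k)"
      unfolding sum.distrib[symmetric] by (rule sum.cong[OF refl])
    then show ?thesis by (simp add: sum_distrib_left distrib_left)
  qed
  also have "norm \<dots> \<le> norm (of_real (q 0) * (\<Sum>k=1..Suc n. S k)) + norm (\<Sum>k=1..n. of_real (q' (n - k)) * S k)"
    by (rule norm_triangle_ineq)
  also have "\<dots> \<le> q 0 * (real (Suc n) * B) + B * (\<Sum>k<n. q' k)"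
  proof (rule add_mono)
    have "norm (of_real (q 0) * (\<Sum>k=1..Suc n. S k)) = q 0 * norm (\<Sum>k=1..Suc n. S k)"
      using Suc.prems(2) by (simp add: norm_mult)
    also have "\<dots> \<le> q 0 * (real (Suc n) * B)"
      by (rule mult_left_mono[OF Suc.prems(4) Suc.prems(2)]) simp_all
    finally show "norm (of_real (q 0) * (\<Sum>k=1..Suc n. S k)) \<le> q 0 * (real (Suc n) * B)" .
    show "norm (\<Sum>k=1..n. of_real (q' (n - k)) * S k) \<le> B * (\<Sum>k<n. q' k)"
      by (rule Suc.IH[OF q' Suc.prems(3) Suc.prems(4)]) simp_all
  qed
  also have "\<dots> = B * (\<Sum>k<Suc n. q k)"
    unfolding sum.lessThan_Suc_shift by (simp add: q'_def sum_subtractf algebra_simps)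
  finally show ?case .
qed simp

section \<open>Powers of extended non-negative reals\<close>

lemma ennreal_powr_half: "0 \<le> w \<Longrightarrow> ennreal_powr (ennreal w) (1 / 2) = ennreal (sqrt w)"
  by (simp add: ennreal_powr_def powr_half_sqrt)

lemma ennreal_powr_2: "0 \<le> w \<Longrightarrow> ennreal_powr (ennreal w) 2 = ennreal (w\<^sup>2)"
  by (simp add: ennreal_powr_def)

lemma ennreal_powr_mono:
  assumes "a \<le> b" "0 \<le> p" shows "ennreal_powr a p \<le> ennreal_powr b p"
proof (cases "b = \<infinity>")
  case False
  then have "a \<noteq> \<infinity>" "b < top" using assms(1) by (auto simp: top_unique less_top)
  then show ?thesis
    using False assms by (auto simp: ennreal_powr_def intro!: ennreal_leI powr_mono2 enn2real_mono)
qed (simp add: ennreal_powr_def)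

text \<open>If the roots have the finite supremum \<open>s\<close>, every \<open>f i\<close> is at
  most the square of \<open>s\<close>. This moves the root inside the supremum before monotone
  convergence is applied.\<close>

lemma ennreal_powr_SUP_le: "ennreal_powr (SUP i. f i) (1 / 2) \<le> (SUP i. ennreal_powr (f i) (1 / 2))"
proof (cases "(SUP i. ennreal_powr (f i) (1 / 2)) = \<infinity>")
  case False
  then obtain s where s: "0 \<le> s" "(SUP i. ennreal_powr (f i) (1 / 2)) = ennreal s"
    by (metis ennreal_cases infinity_ennreal_def)
  have "f i \<le> ennreal (s\<^sup>2)" for i
  proof (cases "f i")
    case (real r)
    have "ennreal_powr (f i) (1 / 2) \<le> ennreal s"
      unfolding s(2)[symmetric] by (rule SUP_upper) simp
    then have "sqrt r \<le> s" using real s(1) by (simp add: ennreal_powr_half)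
    then have "r \<le> s\<^sup>2" by (rule sqrt_le_D)
    then show ?thesis using real by (simp add: ennreal_leI)
  next
    case top
    then have "(SUP i. ennreal_powr (f i) (1 / 2)) = \<infinity>"
      by (intro antisym SUP_upper2[of i]) (auto simp: ennreal_powr_def)
    with False show ?thesis by simp
  qed
  then have "ennreal_powr (SUP i. f i) (1 / 2) \<le> ennreal_powr (ennreal (s\<^sup>2)) (1 / 2)"
    by (intro ennreal_powr_mono SUP_least) auto
  also have "\<dots> = ennreal s" using s(1) by (simp add: ennreal_powr_half)
  finally show ?thesis unfolding s(2) .
next
  case True
  then show ?thesis by (simp only: infinity_ennreal_def top_greatest)
qed

text \<open>The algebra matching kernel bounds with the coefficients of \<open>atom_bound\<close>:
  \<open>r\<close>, \<open>x\<close>, \<open>y\<close>, \<open>q\<close>, \<open>p\<close>,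
  \<open>d\<close> stand for \<open>R\<close>, \<open>M k\<close>, \<open>M l\<close>,
  \<open>M N\<close>, \<open>N\<close>, \<open>ln 2\<close>. The first identity serves
  \<open>l < N\<close>, the second \<open>l = N\<close>.\<close>

lemma rescale_identities:
  fixes r :: real
  shows "r\<^sup>2 * x * y / q * (g / ((p * d)\<^sup>2 * q)) = (r * (1 / p) / (d * q))\<^sup>2 * x * y * g"
    and "q \<noteq> 0 \<Longrightarrow> n * x / q * (r\<^sup>2 * w / d\<^sup>2) = (r * 1 / (d * q))\<^sup>2 * x * q * (n * w)"
  by (simp_all add: power2_eq_square mult_ac)

section \<open>Generalised powers, digits and characters\<close>

locale vilenkin_system =
  fixes m :: "nat \<Rightarrow> nat" and R :: real
  assumes m_ge_2: "\<And>k. 2 \<le> m k" and m_le: "\<And>k. real (m k) \<le> R"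
begin

abbreviation M :: "nat \<Rightarrow> nat" where "M \<equiv> gen_power m"
text \<open>A number is read as the point of the group whose coordinates are its digits.\<close>

abbreviation pt :: "nat \<Rightarrow> nat \<Rightarrow> nat" where "pt a \<equiv> digit m a"
abbreviation psi :: "nat \<Rightarrow> (nat \<Rightarrow> nat) \<Rightarrow> complex" where "psi \<equiv> vilenkin m"

lemma R_ge_2: "2 \<le> R"
  using m_ge_2[of 0] m_le[of 0] by linarith

lemma M_pos [simp]: "0 < M k"
  using gen_power_pos[OF m_ge_2] .

lemma M_neq_0 [simp]: "M k \<noteq> 0"
  by simp

lemma M_dvd: "k \<le> l \<Longrightarrow> M k dvd M l"
  by (induction l rule: dec_induct) auto

lemma M_mono: "k \<le> l \<Longrightarrow> M k \<le> M l"
  by (rule dvd_imp_le[OF M_dvd]) auto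

lemma two_pow_le_M: "2 ^ k \<le> M k"
  by (induction k) (auto intro: mult_mono m_ge_2)

lemma M_Suc_le: "real (M (Suc k)) \<le> R * real (M k)"
  using m_le[of k] by (auto intro: mult_right_mono)

text \<open>The roots grow at least by the factor \<open>sqrt 2\<close>; the constant 3 survives the
  induction because \<open>3 + 1 \<le> 3 * sqrt 2\<close>, that is,
  \<open>16 \<le> 18\<close>.\<close>

lemma sum_sqrt_M: "(\<Sum>k<l. sqrt (real (M k))) \<le> 3 * sqrt (real (M l))"
proof (induction l)
  case (Suc l)
  have "4 * sqrt (real (M l)) = sqrt (16 * real (M l))"
    by (simp add: real_sqrt_mult)
  also have "\<dots> \<le> sqrt (9 * real (M (Suc l)))"
  proof (rule real_sqrt_le_mono)
    have "2 * real (M l) \<le> real (m l) * real (M l)"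
      using m_ge_2[of l] by (intro mult_right_mono) auto
    moreover have "0 < real (M l)" by simp
    ultimately show "16 * real (M l) \<le> 9 * real (M (Suc l))" by simp
  qed
  also have "\<dots> = 3 * sqrt (real (M (Suc l)))"
    by (simp add: real_sqrt_mult)
  finally show ?case using Suc by simp
qed simp

lemma pt_less: "pt a j < m j"
  by (rule digit_less[OF m_ge_2])

lemma pt_in_group: "pt a \<in> vilenkin_group m"
  by (simp add: vilenkin_group_def PiE_iff extensional_def pt_less)

lemma digit_mod:
  assumes "j < N" shows "digit m (a mod M N) j = digit m a j"
proof -
  obtain q where q: "M N = M (Suc j) * q"
    using M_dvd[of "Suc j" N] assms by auto
  have "a mod M N mod M (Suc j) = a mod M (Suc j)"
    unfolding q by (simp add: mod_mod_cancel)
  moreover have "b mod (M j * m j) div M j = b div M j mod m j" for b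
    by (simp add: mod_mult2_eq)
  ultimately show ?thesis
    unfolding digit_def by (metis gen_power.simps(2) mult.commute)
qed

lemma mod_eq_iff_digits:
  "a mod M N = b mod M N \<longleftrightarrow> (\<forall>j<N. digit m a j = digit m b j)"
proof
  assume "a mod M N = b mod M N"
  then show "\<forall>j<N. digit m a j = digit m b j" by (metis digit_mod)
next
  assume "\<forall>j<N. digit m a j = digit m b j"
  then show "a mod M N = b mod M N"
    unfolding sum_digit_mod[symmetric] by (intro sum.cong) auto
qed

lemma digit_shift_low:
  assumes "b < M k" "j < k" shows "digit m (c * M k + b) j = digit m b j"
  using digit_mod[OF assms(2), of "c * M k + b"] assms by simp

lemma digit_shift_high:
  assumes "b < M k" "k \<le> j" shows "digit m (c * M k + b) j = digit m (c * M k) j"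
proof -
  obtain q where q: "M j = M k * q" using M_dvd[OF assms(2)] by auto
  show ?thesis
    unfolding digit_def q using assms(1) by (simp add: div_mult2_eq)
qed

lemma digit_mult_low:
  assumes "j < k" shows "digit m (c * M k) j = 0"
  using digit_shift_low[of 0 k j c] assms by (simp add: digit_def)

lemma digit_eq_0_if_less: "n < M K \<Longrightarrow> K \<le> j \<Longrightarrow> digit m n j = 0"
  using M_mono[of K j] by (simp add: digit_def)

lemma psi_eq_prod:
  assumes "n < M K" shows "psi n x = (\<Prod>j<K. rademacher m j x ^ digit m n j)"
  unfolding vilenkin_def
  by (intro prodinf_finite) (auto simp: digit_eq_0_if_less[OF assms])

lemma norm_rademacher [simp]: "norm (rademacher m k x) = 1"
  by (simp add: rademacher_def)

lemma norm_psi [simp]: "norm (psi n x) = 1"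
  unfolding psi_eq_prod[OF less_gen_power[OF m_ge_2]] by (simp add: prod_norm[symmetric] norm_power)

lemma psi_cong:
  assumes "n < M N" "\<And>j. j < N \<Longrightarrow> x j = y j" shows "psi n x = psi n y"
  unfolding psi_eq_prod[OF assms(1)] by (auto intro!: prod.cong simp: rademacher_def assms(2))

text \<open>The digits of \<open>c * M k\<close> sit at positions from \<open>k\<close> on and those
  of \<open>b\<close> below \<open>k\<close>, so there are no carries and the exponents add.\<close>

lemma psi_shift:
  assumes b: "b < M k" shows "psi (c * M k + b) x = psi (c * M k) x * psi b x"
proof -
  let ?K = "k + (c * M k + b)"
  have "c * M k + b < M ?K"
    using less_gen_power[OF m_ge_2, of ?K] by (rule le_less_trans[rotated]) simp
  then have *: "c * M k + b < M ?K" "c * M k < M ?K" "b < M ?K" by auto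
  show ?thesis
    unfolding *[THEN psi_eq_prod] prod.distrib[symmetric]
  proof (intro prod.cong refl)
    fix j
    show "rademacher m j x ^ digit m (c * M k + b) j =
        rademacher m j x ^ digit m (c * M k) j * rademacher m j x ^ digit m b j"
      using b by (cases "j < k") (auto simp: digit_shift_low digit_shift_high digit_mult_low
          digit_eq_0_if_less)
  qed
qed

lemma psi_digit:
  assumes "d < m k" shows "psi (d * M k) x = rademacher m k x ^ d"
proof -
  have "d * M k < M (Suc k)" using assms by simp
  then have "psi (d * M k) x = (\<Prod>j<Suc k. rademacher m j x ^ digit m (d * M k) j)"
    by (rule psi_eq_prod)
  also have "\<dots> = rademacher m k x ^ digit m (d * M k) k"
    by (simp add: digit_mult_low)
  also have "digit m (d * M k) k = d" using assms by (simp add: digit_def)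
  finally show ?thesis .
qed

subsection \<open>Kernels\<close>

text \<open>The character at the group difference of \<open>x\<close> and \<open>y\<close>,
  expressed without subtraction in the group. Kernels accordingly take two points.\<close>

definition psi2 :: "nat \<Rightarrow> (nat \<Rightarrow> nat) \<Rightarrow> (nat \<Rightarrow> nat) \<Rightarrow> complex" where
  "psi2 n x y = psi n x * cnj (psi n y)"

definition dirichlet :: "(nat \<Rightarrow> nat) \<Rightarrow> (nat \<Rightarrow> nat) \<Rightarrow> nat \<Rightarrow> complex" where
  "dirichlet x y n = (\<Sum>k<n. psi2 k x y)"

text \<open>Since \<open>dirichlet x y 0 = 0\<close>, it is \<open>fejer_sum x y (Suc n)\<close>
  that equals \<open>n\<close> times the \<open>n\<close>-th Fejer kernel.\<close>

definition fejer_sum :: "(nat \<Rightarrow> nat) \<Rightarrow> (nat \<Rightarrow> nat) \<Rightarrow> nat \<Rightarrow> complex" where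
  "fejer_sum x y n = (\<Sum>j<n. dirichlet x y j)"

lemma norm_psi2 [simp]: "norm (psi2 n x y) = 1"
  by (simp add: psi2_def norm_mult)

lemma psi2_shift: "b < M k \<Longrightarrow> psi2 (c * M k + b) x y = psi2 (c * M k) x y * psi2 b x y"
  by (simp add: psi2_def psi_shift)

lemma norm_dirichlet_le: "norm (dirichlet x y n) \<le> n"
  unfolding dirichlet_def by (rule order_trans[OF norm_sum]) simp

lemma dirichlet_shift:
  assumes "r \<le> M k"
  shows "dirichlet x y (c * M k + r) = dirichlet x y (c * M k) + psi2 (c * M k) x y * dirichlet x y r"
  unfolding dirichlet_def sum_lessThan_add sum_distrib_left
  using assms by (auto intro!: sum.cong simp: psi2_shift)

definition differ_at :: "(nat \<Rightarrow> nat) \<Rightarrow> (nat \<Rightarrow> nat) \<Rightarrow> nat \<Rightarrow> bool" where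
  "differ_at x y k \<longleftrightarrow> x k \<noteq> y k \<and> x k < m k \<and> y k < m k"

text \<open>The summands are the powers of \<open>z\<close>, the root of unity with angle
  proportional to \<open>x k - y k\<close>. The digits differ modulo \<open>m k\<close>, so
  \<open>z \<noteq> 1\<close> while \<open>z ^ m k = 1\<close>, and the geometric sum
  vanishes.\<close>

lemma sum_psi2_digit_eq_0:
  assumes "differ_at x y k"
  shows "(\<Sum>d<m k. psi2 (d * M k) x y) = 0"
proof -
  define z where "z = rademacher m k x * cnj (rademacher m k y)"
  have mk: "real (m k) > 0" using m_ge_2[of k] by simp
  have z: "z = cis (2 * pi * (real (x k) - real (y k)) / real (m k))"
  proof -
    have "rademacher m k w = cis (2 * pi * real (w k) / real (m k))" for w
      by (simp add: rademacher_def cis_conv_exp mult_ac)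
    then show ?thesis unfolding z_def by (simp add: cis_cnj cis_mult diff_divide_distrib ring_distribs)
  qed
  have "z \<noteq> 1"
  proof
    assume "z = 1"
    then have "cos (2 * pi * (real (x k) - real (y k)) / real (m k)) = 1"
      unfolding z by (metis cis.sel(1) one_complex.sel(1))
    then obtain i :: int where "2 * pi * (real (x k) - real (y k)) / real (m k) = of_int i * 2 * pi"
      unfolding cos_one_2pi_int by auto
    then have "real (x k) - real (y k) = of_int i * real (m k)"
    proof -
      have "2 * pi * (real (x k) - real (y k)) = 2 * pi * (of_int i * real (m k))"
        using mk \<open>_ = of_int i * 2 * pi\<close> by (simp add: divide_eq_eq mult_ac)
      then show ?thesis by (simp only: mult_cancel_left) simp
    qed
    then have "of_int (int (x k) - int (y k)) = (of_int (i * int (m k)) :: real)"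
      by simp
    then have eq: "int (x k) - int (y k) = i * int (m k)"
      unfolding of_int_eq_iff .
    then have "int (m k) dvd int (x k) - int (y k)" by simp
    moreover have "\<bar>int (x k) - int (y k)\<bar> < int (m k)" using assms unfolding differ_at_def by linarith
    ultimately have "int (x k) - int (y k) = 0"
      using dvd_imp_le_int by (metis abs_of_nat linorder_not_less)
    with assms show False by (simp add: differ_at_def)
  qed
  moreover have "z ^ m k = 1"
  proof -
    have "z ^ m k = cis (2 * pi * of_int (int (x k) - int (y k)))"
      unfolding z Complex.DeMoivre using mk by simp
    then show ?thesis by (metis cis_multiple_2pi Ints_of_int)
  qed
  ultimately have "(\<Sum>d<m k. z ^ d) = 0" by (simp add: sum_gp_strict)
  moreover have "(\<Sum>d<m k. psi2 (d * M k) x y) = (\<Sum>d<m k. z ^ d)"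
    by (intro sum.cong refl) (simp add: psi2_def psi_digit z_def power_mult_distrib)
  ultimately show ?thesis by simp
qed

text \<open>Splitting off the leading digit factors the kernel of index \<open>M (Suc k)\<close>
  into the vanishing character sum and the kernel of index \<open>M k\<close>. Multiples of
  \<open>M (Suc k)\<close> follow block by block, and \<open>M l\<close> is one of them.\<close>

lemma dirichlet_block_eq_0:
  assumes "differ_at x y k" "k < l"
  shows "dirichlet x y (c * M l) = 0"
proof -
  have "dirichlet x y (M (Suc k)) = (\<Sum>d<m k. psi2 (d * M k) x y) * dirichlet x y (M k)"
    unfolding dirichlet_def gen_power.simps sum_block sum_product
    by (intro sum.cong refl) (simp add: psi2_shift)
  then have 0: "dirichlet x y (M (Suc k)) = 0"
    using sum_psi2_digit_eq_0[OF assms(1)] by simp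
  have *: "dirichlet x y (c * M (Suc k)) = 0" for c
  proof (induction c)
    case (Suc c)
    then show ?case using dirichlet_shift[of "M (Suc k)" "Suc k" x y c] 0
      by (simp add: add.commute)
  qed (simp add: dirichlet_def)
  obtain q where "M l = M (Suc k) * q" using M_dvd[of "Suc k" l] assms(2) by auto
  then show ?thesis using *[of "c * q"] by (simp add: mult_ac)
qed

text \<open>Full blocks cancel; what remains has at most \<open>M (Suc k)\<close> terms of modulus
  1.\<close>

lemma norm_dirichlet_le_M:
  assumes "differ_at x y k"
  shows "norm (dirichlet x y n) \<le> M (Suc k)"
proof -
  define c where "c = n div M (Suc k)"
  define r where "r = n mod M (Suc k)"
  have r: "r \<le> M (Suc k)" using M_pos[of "Suc k"] unfolding r_def by (simp del: gen_power.simps M_pos add: less_imp_le)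
  have "n = c * M (Suc k) + r" unfolding c_def r_def by (simp only: div_mult_mod_eq)
  then have "dirichlet x y n = psi2 (c * M (Suc k)) x y * dirichlet x y r"
    using dirichlet_shift[OF r, of x y c] dirichlet_block_eq_0[OF assms, of "Suc k" c]
    by simp
  then have "norm (dirichlet x y n) \<le> r"
    by (simp add: norm_mult norm_dirichlet_le)
  with r show ?thesis by linarith
qed

lemma norm_fejer_sum_le:
  assumes "\<And>j. j < n \<Longrightarrow> norm (dirichlet x y j) \<le> B"
  shows "norm (fejer_sum x y n) \<le> real n * B"
  unfolding fejer_sum_def
  using sum_norm_bound[of "{..<n}" "dirichlet x y" B] assms by simp

text \<open>The summand of index 0 vanishes, which gives the factor \<open>n\<close> instead of
  \<open>Suc n\<close>.\<close>

lemma norm_fejer_sum_Suc_le: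
  assumes "\<And>j. j \<le> n \<Longrightarrow> norm (dirichlet x y j) \<le> B"
  shows "norm (fejer_sum x y (Suc n)) \<le> real n * B"
proof -
  have "fejer_sum x y (Suc n) = (\<Sum>j<n. dirichlet x y (Suc j))"
    unfolding fejer_sum_def sum.lessThan_Suc_shift by (simp add: dirichlet_def)
  then show ?thesis
    using sum_norm_bound[of "{..<n}" "\<lambda>j. dirichlet x y (Suc j)" B] assms by simp
qed

text \<open>Beyond digit \<open>k\<close> the Dirichlet kernel vanishes at block starts, so it is
  itself multiplicative under shifts by \<open>c * M j\<close>. The cancellation argument at digit
  \<open>l\<close> thus applies to sums of Dirichlet kernels: full blocks of
  \<open>M (Suc l)\<close> vanish, and each remaining summand is at most
  \<open>M (Suc k)\<close>.\<close>

lemma norm_fejer_sum_le_M: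
  assumes k: "differ_at x y k" and l: "differ_at x y l" and "k < l"
  shows "norm (fejer_sum x y n) \<le> real (M (Suc k)) * real (M (Suc l))"
proof -
  have shift: "fejer_sum x y (c * M j + r) = fejer_sum x y (c * M j) + psi2 (c * M j) x y * fejer_sum x y r"
    if "k < j" "r \<le> M j" for c j r
    unfolding fejer_sum_def sum_lessThan_add sum_distrib_left
    using that by (auto intro!: sum.cong simp: dirichlet_shift dirichlet_block_eq_0[OF k])
  have "fejer_sum x y (M (Suc l)) = (\<Sum>d<m l. \<Sum>r<M l. dirichlet x y (d * M l + r))"
    by (simp add: fejer_sum_def sum_block)
  also have "\<dots> = (\<Sum>d<m l. psi2 (d * M l) x y) * fejer_sum x y (M l)"
    unfolding fejer_sum_def sum_product
    by (intro sum.cong refl) (simp add: dirichlet_shift dirichlet_block_eq_0[OF k \<open>k < l\<close>])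
  finally have 0: "fejer_sum x y (M (Suc l)) = 0"
    using sum_psi2_digit_eq_0[OF l] by simp
  have block: "fejer_sum x y (c * M (Suc l)) = 0" for c
  proof (induction c)
    case (Suc c)
    then show ?case using shift[of "Suc l" "M (Suc l)" c] 0 \<open>k < l\<close>
      by (simp add: add.commute)
  qed (simp add: fejer_sum_def)
  define c where "c = n div M (Suc l)"
  define r where "r = n mod M (Suc l)"
  have r: "r \<le> M (Suc l)"
    using M_pos[of "Suc l"] unfolding r_def by (simp del: gen_power.simps M_pos add: less_imp_le)
  have "n = c * M (Suc l) + r" unfolding c_def r_def by (simp only: div_mult_mod_eq)
  then have "norm (fejer_sum x y n) = norm (fejer_sum x y r)"
    using shift[of "Suc l" r c] r block[of c] \<open>k < l\<close> by (simp add: norm_mult)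
  also have "\<dots> \<le> real r * real (M (Suc k))"
    by (intro norm_fejer_sum_le norm_dirichlet_le_M k)
  also have "\<dots> \<le> real (M (Suc l)) * real (M (Suc k))"
    using r by (intro mult_right_mono of_nat_mono) auto
  finally show ?thesis by (simp add: mult.commute)
qed

subsection \<open>The finite model\<close>

definition cls :: "nat \<Rightarrow> nat \<Rightarrow> nat \<Rightarrow> nat set" where
  "cls L N c = {t. t < M L \<and> t mod M N = c mod M N}"

lemma finite_cls [simp]: "finite (cls L N c)"
  by (simp add: cls_def)

lemma cls_subset: "cls L N c \<subseteq> {..<M L}"
  by (auto simp: cls_def)

lemma mod_eq_mono:
  assumes "a mod M N = b mod M N" "K \<le> N" shows "a mod M K = b mod M K"
  using assms mod_eq_iff_digits by auto

lemma card_cls: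
  assumes "N \<le> L" shows "real (card (cls L N c)) = real (M L) / real (M N)"
proof -
  obtain q where q: "M L = M N * q" using M_dvd[OF assms] by auto
  have "cls L N c = (\<lambda>i. i * M N + c mod M N) ` {..<q}"
  proof (intro equalityI subsetI)
    fix t assume t: "t \<in> cls L N c"
    then have "t = (t div M N) * M N + c mod M N"
      unfolding cls_def by (metis (mono_tags, lifting) div_mult_mod_eq mem_Collect_eq)
    moreover have "t div M N < q"
      using t q by (simp add: cls_def less_mult_imp_div_less mult.commute)
    ultimately show "t \<in> (\<lambda>i. i * M N + c mod M N) ` {..<q}" by blast
  next
    fix t assume "t \<in> (\<lambda>i. i * M N + c mod M N) ` {..<q}"
    then obtain i where i: "i < q" "t = i * M N + c mod M N" by auto
    have "t < i * M N + M N" using i by simp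
    also have "\<dots> = Suc i * M N" by simp
    also have "\<dots> \<le> q * M N" using i by (intro mult_right_mono) auto
    finally show "t \<in> cls L N c" using i q by (simp add: cls_def mult.commute)
  qed
  moreover have "inj_on (\<lambda>i. i * M N + c mod M N) {..<q}"
    using M_pos[of N] by (auto intro!: inj_onI simp del: M_pos)
  ultimately have "card (cls L N c) = q" by (simp add: card_image)
  then show ?thesis by (simp add: q)
qed

lemma card_cls': "N \<le> L \<Longrightarrow> real (card {t. t < M L \<and> t mod M N = c mod M N}) = real (M L) / real (M N)"
  using card_cls by (simp add: cls_def)

lemma differ_at_pt [simp]: "differ_at (pt a) (pt b) k \<longleftrightarrow> digit m a k \<noteq> digit m b k"
  by (simp add: differ_at_def pt_less)

text \<open>If \<open>k < P\<close> is the first digit in which \<open>a\<close> and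
  \<open>t\<close> differ, the bound \<open>M (Suc k)\<close> is one of the summands; if there is
  none, the trivial bound \<open>j \<le> M P\<close> is dominated by the summand
  \<open>s = P\<close>. A sum of indicators is easy to sum over \<open>t\<close>.\<close>

lemma norm_dirichlet_le_sum:
  assumes "j \<le> M P"
  shows "norm (dirichlet (pt a) (pt t) j) \<le>
    (\<Sum>s\<le>P. real (M (Suc s)) * of_bool (t mod M s = a mod M s))"
proof -
  have *: "real (M (Suc k)) \<le> (\<Sum>s\<le>P. real (M (Suc s)) * of_bool (t mod M s = a mod M s))"
    if "k \<le> P" "t mod M k = a mod M k" for k
    using member_le_sum[of k "{..P}" "\<lambda>s. real (M (Suc s)) * of_bool (t mod M s = a mod M s)"] that
    by simp
  show ?thesis
  proof (cases "t mod M P = a mod M P")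
    case True
    have "norm (dirichlet (pt a) (pt t) j) \<le> real (M P)"
      using norm_dirichlet_le[of "pt a" "pt t" j] assms by linarith
    also have "\<dots> \<le> real (M (Suc P))" using M_mono[of P "Suc P"] by simp
    finally show ?thesis using *[of P] True by linarith
  next
    case False
    then have ex: "\<exists>k<P. digit m t k \<noteq> digit m a k" by (simp add: mod_eq_iff_digits)
    define k where "k = (LEAST k. digit m t k \<noteq> digit m a k)"
    have k: "digit m t k \<noteq> digit m a k" unfolding k_def using ex by (metis (mono_tags, lifting) LeastI)
    have "k < P" unfolding k_def using ex by (metis (mono_tags, lifting) Least_le le_less_trans)
    have "t mod M k = a mod M k"
      unfolding mod_eq_iff_digits k_def using not_less_Least by blast
    then show ?thesis
      using *[of k] norm_dirichlet_le_M[of "pt a" "pt t" k j] k \<open>k < P\<close> by simp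
  qed
qed

lemma sum_of_bool_mod:
  assumes "N \<le> L"
  shows "(\<Sum>t<M L. of_bool (t mod M N = c mod M N)) = real (M L) / real (M N)"
  using card_cls'[OF assms, of c] by (simp add: of_bool_def sum.If_cases Int_def)

lemma ln_2_mult_le:
  assumes "M P \<le> n" shows "real P * ln 2 \<le> ln (real n + 1)"
proof -
  have "real P * ln 2 = ln (2 ^ P)" by (simp add: ln_realpow)
  also have "\<dots> \<le> ln (real n + 1)"
  proof (rule ln_mono)
    have "2 ^ P \<le> n" using two_pow_le_M[of P] assms by linarith
    then have "real (2 ^ P) \<le> real n" by (simp only: of_nat_le_iff)
    then have "(2::real) ^ P \<le> real n" by (simp only: of_nat_power of_nat_numeral)
    then show "(2::real) ^ P \<le> real n + 1" by linarith
  qed auto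
  finally show ?thesis .
qed

text \<open>
  The Lebesgue constants of the Fejer kernels are in fact bounded, but the weight absorbs a
  logarithm.
\<close>

lemma sum_norm_fejer_sum_le:
  assumes n: "1 \<le> n" "n \<le> M L"
  shows "(\<Sum>t<M L. norm (fejer_sum (pt a) (pt t) (Suc n))) \<le>
    real (M L) * (3 * R / (ln 2)\<^sup>2) * (real n * (ln (real n + 1))\<^sup>2)"
proof -
  define P where "P = (LEAST P. n \<le> M P)"
  have P: "n \<le> M P" unfolding P_def using n(2) by (rule LeastI)
  have PL: "P \<le> L" unfolding P_def using n(2) by (rule Least_le)
  let ?S = "\<lambda>t. \<Sum>s\<le>P. real (M (Suc s)) * of_bool (t mod M s = a mod M s)"
  have "(\<Sum>t<M L. norm (fejer_sum (pt a) (pt t) (Suc n))) \<le> (\<Sum>t<M L. real n * ?S t)"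
    using P by (intro sum_mono norm_fejer_sum_Suc_le norm_dirichlet_le_sum) auto
  also have "\<dots> = real n * (\<Sum>s\<le>P. real (M (Suc s)) * (\<Sum>t<M L. of_bool (t mod M s = a mod M s)))"
    unfolding sum_distrib_left by (subst sum.swap) (rule refl)
  \<comment> \<open>The size of each residue class cancels the kernel bound up to
    \<open>m s\<close>, so all \<open>P + 1\<close> scales contribute equally, and \<open>P\<close>
    is of logarithmic size.\<close>
  also have "\<dots> = real n * (\<Sum>s\<le>P. real (M (Suc s)) * (real (M L) / real (M s)))"
    using PL by (intro arg_cong[where f = "\<lambda>x. real n * x"] sum.cong refl) (subst sum_of_bool_mod; simp)
  also have "\<dots> = real n * (\<Sum>s\<le>P. real (m s) * real (M L))"
    by simp
  also have "\<dots> \<le> real n * (\<Sum>s\<le>P. R * real (M L))"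
    by (intro mult_left_mono sum_mono mult_right_mono m_le) auto
  also have "\<dots> = real (M L) * R * real n * (real P + 1)" by (simp add: mult_ac)
  also have "\<dots> \<le> real (M L) * R * real n * (3 * ((ln (real n + 1))\<^sup>2 / (ln 2)\<^sup>2))"
  proof (rule mult_left_mono)
    \<comment> \<open>Minimality of \<open>P\<close> gives \<open>P \<le> x + 1\<close>, and
      \<open>x \<ge> 1\<close> turns \<open>x + 2\<close> into at most \<open>3 * x\<^sup>2\<close>;
      this is the 3 in the constant.\<close>
    define x where "x = ln (real n + 1) / ln 2"
    have ln2: "0 < ln (2::real)" by simp
    have "ln 2 \<le> ln (real n + 1)" using n by (intro ln_mono) auto
    then have x1: "1 \<le> x" unfolding x_def using ln2 by simp
    have "real P \<le> x + 1"
    proof (cases P)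
      case 0 then show ?thesis using x1 by simp
    next
      case (Suc p)
      then have "\<not> n \<le> M p" unfolding P_def by (metis not_less_Least lessI)
      then have "real p * ln 2 \<le> ln (real n + 1)" by (intro ln_2_mult_le) auto
      then have "real p \<le> x" unfolding x_def using ln2 by (simp add: pos_le_divide_eq)
      then show ?thesis using Suc by simp
    qed
    moreover have "x \<le> x\<^sup>2" using x1 by (simp add: power2_eq_square)
    ultimately have "real P + 1 \<le> 3 * x\<^sup>2" using x1 by linarith
    then show "real P + 1 \<le> 3 * ((ln (real n + 1))\<^sup>2 / (ln 2)\<^sup>2)"
      by (simp add: x_def power_divide)
  qed (use R_ge_2 in auto)
  finally show ?thesis by (simp add: mult_ac)
qed

subsection \<open>Atoms\<close>

definition lebesgue_const :: real where
  "lebesgue_const = 3 * R / (ln 2)\<^sup>2"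

definition agree :: "nat \<Rightarrow> nat \<Rightarrow> nat \<Rightarrow> nat \<Rightarrow> bool" where
  "agree k l a c \<longleftrightarrow> (\<forall>s<l. s \<noteq> k \<longrightarrow> digit m a s = digit m c s)"

definition log_weight :: "nat \<Rightarrow> nat \<Rightarrow> real" where
  "log_weight N l = (if l < N then 1 / real N else 1)"

text \<open>
  The indices \<open>k < l\<close> stand for the first two digits below \<open>N\<close> in which \<open>a\<close> and \<open>c\<close> differ, where
  \<open>l = N\<close> means that there is only one. The factor \<open>log_weight\<close> is what \<open>ln (n + 1) \<ge> N ln 2\<close>, valid
  for \<open>n > M N\<close>, gains; it is not needed for \<open>l = N\<close>.
\<close>

definition atom_bound :: "nat \<Rightarrow> nat \<Rightarrow> nat \<Rightarrow> real" where
  "atom_bound N c a = lebesgue_const * of_bool (a mod M N = c mod M N) +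
     (\<Sum>l\<le>N. \<Sum>k<l. (R * log_weight N l / (ln 2 * real (M N)))\<^sup>2 * real (M k) * real (M l) *
        of_bool (agree k l a c))"

lemma lebesgue_const_nonneg: "0 \<le> lebesgue_const"
  using R_ge_2 by (simp add: lebesgue_const_def)

lemma log_weight_nonneg: "0 \<le> log_weight N l"
  by (simp add: log_weight_def)

lemma atom_bound_nonneg: "0 \<le> atom_bound N c a"
  unfolding atom_bound_def
  by (intro add_nonneg_nonneg sum_nonneg mult_nonneg_nonneg lebesgue_const_nonneg) auto

text \<open>Only digit \<open>k\<close> is free. With \<open>e d\<close> the residue of
  \<open>c\<close> modulo \<open>M l\<close> after replacing digit \<open>k\<close> by
  \<open>d\<close>, the set lies in the \<open>m k \<le> R\<close> classes of the numbers
  \<open>e d\<close>.\<close>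

lemma card_agree_le:
  assumes "k < l" "l \<le> L"
  shows "real (card {a. a < M L \<and> agree k l a c}) \<le> R * (real (M L) / real (M l))"
proof -
  define e where "e d = (\<Sum>s<l. (if s = k then d else digit m c s) * M s)" for d
  have "{a. a < M L \<and> agree k l a c} \<subseteq> (\<Union>d<m k. cls L l (e d))"
  proof
    fix a assume "a \<in> {a. a < M L \<and> agree k l a c}"
    then have a: "a < M L" "\<And>s. s < l \<Longrightarrow> s \<noteq> k \<Longrightarrow> digit m a s = digit m c s"
      by (auto simp: agree_def)
    have "a mod M l = e (digit m a k)"
      unfolding e_def sum_digit_mod[symmetric] by (intro sum.cong refl) (auto simp: a(2))
    then have "a mod M l = e (digit m a k) mod M l"
      by (metis mod_mod_trivial)
    then show "a \<in> (\<Union>d<m k. cls L l (e d))"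
      using a(1) pt_less[of a k] by (auto simp: cls_def)
  qed
  then have "card {a. a < M L \<and> agree k l a c} \<le> (\<Sum>d<m k. card (cls L l (e d)))"
    using card_mono card_UN_le[of "{..<m k}" "\<lambda>d. cls L l (e d)"] by (meson finite_UN finite_cls finite_lessThan order_trans)
  then have "real (card {a. a < M L \<and> agree k l a c}) \<le> (\<Sum>d<m k. real (card (cls L l (e d))))"
    by (metis of_nat_le_iff of_nat_sum)
  also have "\<dots> = real (m k) * (real (M L) / real (M l))"
    by (simp add: card_cls[OF assms(2)])
  also have "\<dots> \<le> R * (real (M L) / real (M l))"
    by (intro mult_right_mono m_le) auto
  finally show ?thesis .
qed

text \<open>Here the logarithmic weight pays for the number of positions \<open>l < N\<close> of the
  second differing digit.\<close>

lemma sum_log_weight_le: "(\<Sum>l\<le>N. log_weight N l) \<le> 2"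
proof -
  have "{..N} = insert N {..<N}" by auto
  then have "(\<Sum>l\<le>N. log_weight N l) = 1 + (\<Sum>l<N. 1 / real N)"
    by (simp add: log_weight_def)
  then show ?thesis by simp
qed

text \<open>In the second term, one \<open>R / ln 2\<close> comes from the coefficients of
  \<open>atom_bound\<close>, another \<open>R\<close> from \<open>card_agree_le\<close>, 3 from
  \<open>sum_sqrt_M\<close> and 2 from \<open>sum_log_weight_le\<close>.\<close>

definition atom_const :: real where
  "atom_const = sqrt lebesgue_const + 6 * R\<^sup>2 / ln 2"

text \<open>Taking roots termwise, the pair \<open>k\<close>, \<open>l\<close> contributes
  \<open>sqrt (M k) * sqrt (M l) / M N\<close> on about \<open>M L / M l\<close> points. Summing
  over \<open>k\<close> gives another \<open>sqrt (M l)\<close>, so \<open>M l\<close> cancels and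
  only the sum of \<open>log_weight\<close> is left.\<close>

lemma sum_sqrt_atom_bound_le:
  assumes "N \<le> L"
  shows "(\<Sum>a<M L. sqrt (atom_bound N c a)) \<le> atom_const * (real (M L) / real (M N))"
proof -
  let ?w = "\<lambda>l. R * log_weight N l / (ln 2 * real (M N))"
  have w: "0 \<le> ?w l" for l
    using R_ge_2 log_weight_nonneg[of N l] by simp
  have "sqrt (atom_bound N c a) \<le> sqrt lebesgue_const * of_bool (a mod M N = c mod M N) +
     (\<Sum>l\<le>N. \<Sum>k<l. ?w l * sqrt (real (M k)) * sqrt (real (M l)) * of_bool (agree k l a c))" for a
  proof -
    have 1: "sqrt (atom_bound N c a) \<le> sqrt (lebesgue_const * of_bool (a mod M N = c mod M N)) +
      sqrt (\<Sum>l\<le>N. \<Sum>k<l. (?w l)\<^sup>2 * real (M k) * real (M l) * of_bool (agree k l a c))"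
      unfolding atom_bound_def
      by (intro sqrt_add_le mult_nonneg_nonneg sum_nonneg lebesgue_const_nonneg) auto
    have "sqrt (\<Sum>l\<le>N. \<Sum>k<l. (?w l)\<^sup>2 * real (M k) * real (M l) * of_bool (agree k l a c)) \<le>
      (\<Sum>l\<le>N. sqrt (\<Sum>k<l. (?w l)\<^sup>2 * real (M k) * real (M l) * of_bool (agree k l a c)))"
      by (intro sqrt_sum_le sum_nonneg mult_nonneg_nonneg) simp_all
    also have "\<dots> \<le>
      (\<Sum>l\<le>N. \<Sum>k<l. sqrt ((?w l)\<^sup>2 * real (M k) * real (M l) * of_bool (agree k l a c)))"
      by (intro sum_mono sqrt_sum_le mult_nonneg_nonneg) simp_all
    also have "\<dots> = (\<Sum>l\<le>N. \<Sum>k<l. ?w l * sqrt (real (M k)) * sqrt (real (M l)) * of_bool (agree k l a c))"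
      using w by (intro sum.cong refl) (simp only: real_sqrt_mult real_sqrt_abs abs_of_nonneg, simp)
    finally have 2: "sqrt (\<Sum>l\<le>N. \<Sum>k<l. (?w l)\<^sup>2 * real (M k) * real (M l) * of_bool (agree k l a c)) \<le>
      (\<Sum>l\<le>N. \<Sum>k<l. ?w l * sqrt (real (M k)) * sqrt (real (M l)) * of_bool (agree k l a c))" .
    have 3: "sqrt (lebesgue_const * of_bool (a mod M N = c mod M N)) =
      sqrt lebesgue_const * of_bool (a mod M N = c mod M N)"
      by simp
    from 1 2 show ?thesis unfolding 3 by linarith
  qed
  then have "(\<Sum>a<M L. sqrt (atom_bound N c a)) \<le>
     (\<Sum>a<M L. sqrt lebesgue_const * of_bool (a mod M N = c mod M N) +
     (\<Sum>l\<le>N. \<Sum>k<l. ?w l * sqrt (real (M k)) * sqrt (real (M l)) * of_bool (agree k l a c)))"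
    by (rule sum_mono)
  also have "\<dots> = sqrt lebesgue_const * (\<Sum>a<M L. of_bool (a mod M N = c mod M N)) +
     (\<Sum>l\<le>N. \<Sum>k<l. ?w l * sqrt (real (M k)) * sqrt (real (M l)) * (\<Sum>a<M L. of_bool (agree k l a c)))"
    unfolding sum.distrib sum_distrib_left
    by (subst sum.swap, subst (2) sum.swap) (rule refl)
  also have "\<dots> \<le> sqrt lebesgue_const * (real (M L) / real (M N)) +
     (\<Sum>l\<le>N. \<Sum>k<l. ?w l * sqrt (real (M k)) * sqrt (real (M l)) * (R * (real (M L) / real (M l))))"
  proof (intro add_mono sum_mono mult_left_mono mult_nonneg_nonneg w)
    fix k l assume "l \<in> {..N}" "k \<in> {..<l}"
    then have "real (card {a. a < M L \<and> agree k l a c}) \<le> R * (real (M L) / real (M l))"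
      using assms by (intro card_agree_le) auto
    then show "(\<Sum>a<M L. of_bool (agree k l a c)) \<le> R * (real (M L) / real (M l))"
      by (simp add: of_bool_def sum.If_cases Int_def)
  next
    show "(\<Sum>a<M L. of_bool (a mod M N = c mod M N)) \<le> real (M L) / real (M N)"
      by (subst sum_of_bool_mod[OF assms]) simp
  qed (simp_all add: lebesgue_const_nonneg)
  also have "(\<Sum>l\<le>N. \<Sum>k<l. ?w l * sqrt (real (M k)) * sqrt (real (M l)) * (R * (real (M L) / real (M l)))) =
     (\<Sum>l\<le>N. ?w l * (R * real (M L) / sqrt (real (M l))) * (\<Sum>k<l. sqrt (real (M k))))"
  proof -
    \<comment> \<open>Here \<open>s\<close> is \<open>sqrt (M l)\<close>, with \<open>M l\<close>
      written as \<open>s * s\<close>.\<close>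
    have aux: "w * x * s * (r * (y / (s * s))) = w * (r * y / s) * x" if "s \<noteq> 0" for w x s r y :: real
      using that by (simp add: field_simps)
    show ?thesis
      unfolding sum_distrib_left
    proof (intro sum.cong refl)
      fix l k
      have "sqrt (real (M l)) \<noteq> 0" by simp
      from aux[OF this, of "?w l" "sqrt (real (M k))" R "real (M L)"]
      show "?w l * sqrt (real (M k)) * sqrt (real (M l)) * (R * (real (M L) / real (M l))) =
          ?w l * (R * real (M L) / sqrt (real (M l))) * sqrt (real (M k))"
        by (simp only: real_sqrt_mult_self abs_of_nat)
    qed
  qed
  also have "\<dots> \<le> (\<Sum>l\<le>N. ?w l * (R * real (M L) / sqrt (real (M l))) * (3 * sqrt (real (M l))))"
    using R_ge_2 by (intro sum_mono mult_left_mono sum_sqrt_M mult_nonneg_nonneg w) auto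
  also have "\<dots> = 3 * R\<^sup>2 / ln 2 * (real (M L) / real (M N)) * (\<Sum>l\<le>N. log_weight N l)"
    unfolding sum_distrib_left
    by (intro sum.cong refl) (simp add: power2_eq_square)
  also have "\<dots> \<le> 3 * R\<^sup>2 / ln 2 * (real (M L) / real (M N)) * 2"
    by (intro mult_left_mono sum_log_weight_le) auto
  also have "3 * R\<^sup>2 / ln 2 * (real (M L) / real (M N)) * 2 = 6 * R\<^sup>2 / ln 2 * (real (M L) / real (M N))"
    by simp
  finally show ?thesis unfolding atom_const_def distrib_right by simp
qed

text \<open>The bound for bounded functions, used for an atom at points of its own class and for the
  bounded part of the decomposition.\<close>

lemma norm_sum_fejer_sum_const_le:
  assumes n: "1 \<le> n" "n \<le> M L" and T: "T \<subseteq> {..<M L}"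
    and b: "\<And>t. t \<in> T \<Longrightarrow> norm (b t) \<le> A" and "0 \<le> A"
  shows "norm (\<Sum>t\<in>T. b t * fejer_sum (pt a) (pt t) (Suc n)) \<le>
    real (M L) * A * lebesgue_const * (real n * (ln (real n + 1))\<^sup>2)"
proof -
  have "norm (\<Sum>t\<in>T. b t * fejer_sum (pt a) (pt t) (Suc n)) \<le>
    (\<Sum>t\<in>T. A * norm (fejer_sum (pt a) (pt t) (Suc n)))"
    by (intro sum_norm_le) (auto simp: norm_mult intro!: mult_right_mono b)
  also have "\<dots> \<le> (\<Sum>t<M L. A * norm (fejer_sum (pt a) (pt t) (Suc n)))"
    using T \<open>0 \<le> A\<close> by (intro sum_mono2) auto
  also have "\<dots> = A * (\<Sum>t<M L. norm (fejer_sum (pt a) (pt t) (Suc n)))"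
    by (simp add: sum_distrib_left)
  also have "\<dots> \<le> A * (real (M L) * (3 * R / (ln 2)\<^sup>2) * (real n * (ln (real n + 1))\<^sup>2))"
    using \<open>0 \<le> A\<close> n by (intro mult_left_mono sum_norm_fejer_sum_le) auto
  finally show ?thesis by (simp add: lebesgue_const_def mult_ac)
qed

text \<open>At points of the support the sup bound suffices. Elsewhere the mean value zero kills all
  \<open>n \<le> M N\<close>, and for larger \<open>n\<close> the cancellation of the kernel in the
  first one or two digits separating \<open>a\<close> from the class is used. The bound
  \<open>atom_bound N c a\<close> is the same for all \<open>n\<close>.\<close>

lemma norm_sum_fejer_sum_atom_le:
  assumes n: "1 \<le> n" "n \<le> M L" and N: "N \<le> L"
    and b: "\<And>t. t \<in> cls L N c \<Longrightarrow> norm (b t) \<le> A" and A: "0 \<le> A"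
    and mean: "(\<Sum>t\<in>cls L N c. b t) = 0"
  shows "norm (\<Sum>t\<in>cls L N c. b t * fejer_sum (pt a) (pt t) (Suc n)) \<le>
    real (M L) * A * atom_bound N c a * (real n * (ln (real n + 1))\<^sup>2)"
proof -
  let ?K = "\<lambda>t. fejer_sum (pt a) (pt t) (Suc n)"
  let ?g = "real n * (ln (real n + 1))\<^sup>2"
  let ?w = "\<lambda>l. R * log_weight N l / (ln 2 * real (M N))"
  have g: "0 \<le> ?g" by simp
  have mono: "real (M L) * A * x * ?g \<le> real (M L) * A * atom_bound N c a * ?g"
    if "x \<le> atom_bound N c a" for x
    using that A by (intro mult_right_mono[OF mult_left_mono] g mult_nonneg_nonneg) auto
  show ?thesis
  proof (cases "a mod M N = c mod M N")
    case True
    have 1: "lebesgue_const \<le> atom_bound N c a"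
      unfolding atom_bound_def using True
      by (auto intro!: sum_nonneg)
    have "norm (\<Sum>t\<in>cls L N c. b t * ?K t) \<le> real (M L) * A * lebesgue_const * ?g"
      by (rule norm_sum_fejer_sum_const_le[OF n cls_subset]) (use b A in auto)
    from this mono[OF 1] show ?thesis by (rule order_trans)
  next
    case False
    then have ex: "\<exists>k<N. digit m a k \<noteq> digit m c k" by (simp add: mod_eq_iff_digits)
    then have "N \<noteq> 0" by auto
    have digits: "digit m t s = digit m c s" if "t \<in> cls L N c" "s < N" for t s
      using that by (auto simp: cls_def mod_eq_iff_digits)
    show ?thesis
    proof (cases "n \<le> M N")
      case True
      \<comment> \<open>Characters of index below \<open>M N\<close> see only the first
        \<open>N\<close> digits, so the kernel is constant on the support.\<close>
      have "?K t = ?K c" if t: "t \<in> cls L N c" for t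
      proof -
        have "psi2 i (pt a) (pt t) = psi2 i (pt a) (pt c)" if "i < M N" for i
          unfolding psi2_def using psi_cong[OF that, of "pt t" "pt c"] digits[OF t] by simp
        then have "dirichlet (pt a) (pt t) j = dirichlet (pt a) (pt c) j" if "j \<le> M N" for j
          unfolding dirichlet_def using that by (intro sum.cong refl) auto
        then show ?thesis unfolding fejer_sum_def using True by (intro sum.cong refl) auto
      qed
      then have "(\<Sum>t\<in>cls L N c. b t * ?K t) = (\<Sum>t\<in>cls L N c. b t) * ?K c"
        unfolding sum_distrib_right by (intro sum.cong refl) simp
      then have "(\<Sum>t\<in>cls L N c. b t * ?K t) = 0" using mean by simp
      then show ?thesis using A atom_bound_nonneg[of N c a] by simp
    next
      case False
      then have nN: "real (M N) \<le> real n" by simp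
      have ln2: "0 < ln (2::real)" by simp
      have lnN: "real N * ln 2 \<le> ln (real n + 1)" using False by (intro ln_2_mult_le) auto
      have ln1: "ln 2 \<le> ln (real n + 1)" using n by (intro ln_mono) auto
      define k where "k = (LEAST k. digit m a k \<noteq> digit m c k)"
      have k: "digit m a k \<noteq> digit m c k" unfolding k_def using ex by (metis (mono_tags, lifting) LeastI)
      have "k < N" unfolding k_def using ex by (metis (mono_tags, lifting) Least_le le_less_trans)
      have kmin: "digit m a s = digit m c s" if "s < k" for s
        using that unfolding k_def using not_less_Least by blast
      have kt: "differ_at (pt a) (pt t) k" if "t \<in> cls L N c" for t
        using k digits[OF that \<open>k < N\<close>] by simp
      \<comment> \<open>Both remaining cases end alike: a uniform kernel bound \<open>B\<close> over
        the \<open>M L / M N\<close> points of the support is absorbed by the single summand of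
        \<open>atom_bound\<close> with indices \<open>k\<close> and \<open>l\<close>.\<close>
      have main: ?thesis if l: "k < l" "l \<le> N" "agree k l a c"
        and K: "\<And>t. t \<in> cls L N c \<Longrightarrow> norm (?K t) \<le> B"
        and B: "B / real (M N) \<le> (?w l)\<^sup>2 * real (M k) * real (M l) * ?g" for l B
      proof -
        have "norm (\<Sum>t\<in>cls L N c. b t * ?K t) \<le> (\<Sum>t\<in>cls L N c. A * B)"
          using A by (intro sum_norm_le) (simp add: norm_mult mult_mono b K)
        also have "\<dots> = real (M L) * A * (B / real (M N))"
          by (simp add: card_cls[OF N])
        also have "\<dots> \<le> real (M L) * A * ((?w l)\<^sup>2 * real (M k) * real (M l) * ?g)"
          using A by (intro mult_left_mono B mult_nonneg_nonneg) auto
        also have "\<dots> = real (M L) * A * ((?w l)\<^sup>2 * real (M k) * real (M l)) * ?g"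
          by (simp only: mult.assoc)
        also have "\<dots> \<le> real (M L) * A * atom_bound N c a * ?g"
        proof (rule mono)
          let ?f = "\<lambda>l k. (?w l)\<^sup>2 * real (M k) * real (M l) * of_bool (agree k l a c)"
          have "?f l k \<le> (\<Sum>k<l. ?f l k)"
            by (rule member_le_sum[of k "{..<l}" "?f l"]) (use l in simp_all)
          moreover have "(\<Sum>k<l. ?f l k) \<le> (\<Sum>l\<le>N. \<Sum>k<l. ?f l k)"
            by (rule member_le_sum[of l "{..N}" "\<lambda>l. \<Sum>k<l. ?f l k"])
              (use l in \<open>simp_all add: sum_nonneg\<close>)
          moreover have "0 \<le> lebesgue_const * of_bool (a mod M N = c mod M N)"
            using lebesgue_const_nonneg by simp
          ultimately have "?f l k \<le> atom_bound N c a"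
            unfolding atom_bound_def by linarith
          then show "(?w l)\<^sup>2 * real (M k) * real (M l) \<le> atom_bound N c a"
            using l by simp
        qed
        finally show ?thesis .
      qed
      show ?thesis
      proof (cases "\<exists>l<N. k < l \<and> digit m a l \<noteq> digit m c l")
        case True
        define l where "l = (LEAST l. k < l \<and> digit m a l \<noteq> digit m c l)"
        obtain j where j: "j < N" "k < j \<and> digit m a j \<noteq> digit m c j" using True by blast
        have l: "k < l \<and> digit m a l \<noteq> digit m c l"
          unfolding l_def by (rule LeastI[of _ j]) (rule j(2))
        have "l \<le> j" unfolding l_def by (rule Least_le) (rule j(2))
        with j(1) have "l < N" by simp
        have lmin: "digit m a s = digit m c s" if "k < s" "s < l" for s
          using that unfolding l_def using not_less_Least by blast
        show ?thesis
        \<comment> \<open>Points of the class share their first \<open>N\<close> digits with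
          \<open>c\<close>, so they differ from \<open>a\<close> at \<open>k\<close> and
          \<open>l\<close>, and cancellation in both digits gives a bound free of
          \<open>n\<close>.\<close>
        proof (rule main[of l "R\<^sup>2 * real (M k) * real (M l)"])
          have "digit m a s = digit m c s" if "s < l" "s \<noteq> k" for s
            using kmin[of s] lmin[of s] that by (cases "s < k") auto
          then show "agree k l a c" unfolding agree_def by blast
          fix t assume t: "t \<in> cls L N c"
          have lt: "differ_at (pt a) (pt t) l"
            using l digits[OF t \<open>l < N\<close>] by simp
          have "norm (?K t) \<le> real (M (Suc k)) * real (M (Suc l))"
            by (rule norm_fejer_sum_le_M[OF kt[OF t] lt]) (use l in simp)
          also have "\<dots> \<le> (R * real (M k)) * (R * real (M l))"
            using R_ge_2 by (intro mult_mono M_Suc_le) auto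
          finally show "norm (?K t) \<le> R\<^sup>2 * real (M k) * real (M l)"
            by (simp add: power2_eq_square mult_ac)
        next
          \<comment> \<open>The case \<open>n > M N\<close> is used twice: \<open>n\<close> supplies
            the second factor \<open>M N\<close> of the denominator, and the logarithm supplies
            \<open>1 / N\<close> in \<open>log_weight\<close>.\<close>
          have "(real N * ln 2)\<^sup>2 * real (M N) \<le> (ln (real n + 1))\<^sup>2 * real n"
            using lnN nN by (intro mult_mono power_mono) auto
          then have "1 \<le> ?g / ((real N * ln 2)\<^sup>2 * real (M N))"
            using \<open>N \<noteq> 0\<close> by (subst le_divide_eq_1_pos) (simp_all add: mult.commute)
          then have "R\<^sup>2 * real (M k) * real (M l) / real (M N) * 1 \<le>
            R\<^sup>2 * real (M k) * real (M l) / real (M N) * (?g / ((real N * ln 2)\<^sup>2 * real (M N)))"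
            by (intro mult_left_mono) auto
          also have "\<dots> = (?w l)\<^sup>2 * real (M k) * real (M l) * ?g"
            using \<open>l < N\<close> by (simp only: log_weight_def if_True rescale_identities(1))
          finally show "R\<^sup>2 * real (M k) * real (M l) / real (M N) \<le> (?w l)\<^sup>2 * real (M k) * real (M l) * ?g"
            by simp
        qed (use l \<open>l < N\<close> in auto)
      next
        case False
        show ?thesis
        \<comment> \<open>With a single differing digit only the Dirichlet kernels are bounded. The
          resulting factor \<open>n\<close> matches that on the right, so
          \<open>log_weight N N = 1\<close> and \<open>ln 2 \<le> ln (n + 1)\<close>
          suffice.\<close>
        proof (rule main[of N "real n * (R * real (M k))"])
          have "digit m a s = digit m c s" if "s < N" "s \<noteq> k" for s
            using kmin[of s] False that by (cases "s < k") auto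
          then show "agree k N a c" unfolding agree_def by blast
          fix t assume t: "t \<in> cls L N c"
          have "norm (?K t) \<le> real n * real (M (Suc k))"
            by (intro norm_fejer_sum_Suc_le norm_dirichlet_le_M kt t)
          also have "\<dots> \<le> real n * (R * real (M k))"
            by (intro mult_left_mono M_Suc_le) auto
          finally show "norm (?K t) \<le> real n * (R * real (M k))" .
        next
          have "R * (ln 2)\<^sup>2 \<le> R\<^sup>2 * (ln (real n + 1))\<^sup>2"
            using R_ge_2 ln1 by (intro mult_mono power_mono) (auto simp: power2_eq_square)
          then have "R \<le> R\<^sup>2 * (ln (real n + 1))\<^sup>2 / (ln 2)\<^sup>2"
            by (simp add: pos_le_divide_eq)
          then have "(real n * real (M k) / real (M N)) * R \<le>
            (real n * real (M k) / real (M N)) * (R\<^sup>2 * (ln (real n + 1))\<^sup>2 / (ln 2)\<^sup>2)"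
            by (intro mult_left_mono) auto
          also have "\<dots> = (?w N)\<^sup>2 * real (M k) * real (M N) * ?g"
            by (simp only: log_weight_def less_irrefl if_False rescale_identities(2) of_nat_eq_0_iff M_neq_0
                not_False_eq_True)
          finally show "real n * (R * real (M k)) / real (M N) \<le> (?w N)\<^sup>2 * real (M k) * real (M N) * ?g"
            by (simp only: mult_ac times_divide_eq_left times_divide_eq_right)
        qed (use \<open>k < N\<close> in auto)
      qed
    qed
  qed
qed

subsection \<open>Stopping times\<close>

text \<open>The first term comes from the part bounded by the lowest level. In the second,
  \<open>sqrt 5\<close> stems from \<open>4 * lam + lam\<close>, \<open>R\<close> from the
  regularity of the filtration and 2 from \<open>sum_dyadic_le\<close>.\<close>

definition hardy_const :: real where
  "hardy_const = 2 * sqrt lebesgue_const + 2 * sqrt 5 * atom_const * R"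

context
  fixes L :: nat and F :: "nat \<Rightarrow> complex"
begin

text \<open>For \<open>N \<le> L\<close>, the conditional expectation of \<open>F\<close> at level
  \<open>N\<close>; the prefactor is the reciprocal of the class size.\<close>

definition avg :: "nat \<Rightarrow> nat \<Rightarrow> complex" where
  "avg N a = of_real (real (M N) / real (M L)) * (\<Sum>t\<in>cls L N a. F t)"

definition max_avg :: "nat \<Rightarrow> real" where
  "max_avg a = Max ((\<lambda>N. norm (avg N a)) ` {..L})"

text \<open>Stopping looks one level ahead, over the whole class: the decision depends only on the
  class of level \<open>N\<close>, yet it is taken before an average exceeds \<open>lam\<close>. The
  first alternative makes \<open>L\<close> the default value of \<open>nu\<close>.\<close>

definition stop :: "real \<Rightarrow> nat \<Rightarrow> nat \<Rightarrow> bool" where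
  "stop lam N a \<longleftrightarrow> L \<le> N \<or> (\<exists>b\<in>cls L N a. lam < norm (avg (Suc N) b))"

definition nu :: "real \<Rightarrow> nat \<Rightarrow> nat" where
  "nu lam a = (LEAST N. stop lam N a)"

definition stopped :: "real \<Rightarrow> nat \<Rightarrow> nat set" where
  "stopped lam N = {d. d < M N \<and> nu lam d = N}"

lemma finite_stopped [simp]: "finite (stopped lam N)"
  by (simp add: stopped_def)

lemma cls_cong: "a mod M N = b mod M N \<Longrightarrow> cls L N a = cls L N b"
  by (simp add: cls_def)

lemma avg_cong: "a mod M N = b mod M N \<Longrightarrow> avg N a = avg N b"
  unfolding avg_def using cls_cong[of a N b] by simp

lemma avg_top: "a < M L \<Longrightarrow> avg L a = F a"
proof -
  assume "a < M L"
  then have "cls L L a = {a}" by (auto simp: cls_def)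
  then show ?thesis by (simp add: avg_def)
qed

lemma norm_avg_le_max: "N \<le> L \<Longrightarrow> norm (avg N a) \<le> max_avg a"
  unfolding max_avg_def by (intro Max_ge) auto

lemma max_avg_nonneg: "0 \<le> max_avg a"
  using norm_avg_le_max[of 0 a] norm_ge_zero order_trans by blast

lemma stop_cong: "a mod M N = b mod M N \<Longrightarrow> stop lam N a \<longleftrightarrow> stop lam N b"
  unfolding stop_def using cls_cong[of a N b] by simp

lemma stop_nu: "stop lam (nu lam a) a"
  unfolding nu_def by (rule LeastI[of _ L]) (simp add: stop_def)

lemma nu_le: "nu lam a \<le> L"
  unfolding nu_def by (rule Least_le) (simp add: stop_def)

lemma not_stop: "N < nu lam a \<Longrightarrow> \<not> stop lam N a"
  unfolding nu_def by (rule not_less_Least)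

text \<open>The decision at level \<open>N\<close> depends only on the residue modulo
  \<open>M N\<close>, and up to level \<open>nu lam a\<close> these residues agree.\<close>

lemma nu_cong:
  assumes "b mod M (nu lam a) = a mod M (nu lam a)" shows "nu lam b = nu lam a"
  unfolding nu_def[of lam b]
proof (rule Least_equality)
  show "stop lam (nu lam a) b" using stop_nu stop_cong[OF assms] by simp
next
  fix N assume "stop lam N b"
  show "nu lam a \<le> N"
  proof (rule ccontr)
    assume "\<not> nu lam a \<le> N"
    then have "N < nu lam a" by simp
    with mod_eq_mono[OF assms, of N] \<open>stop lam N b\<close> stop_cong not_stop show False
      by (meson less_imp_le)
  qed
qed

lemma nu_mono: "lam \<le> lam' \<Longrightarrow> nu lam a \<le> nu lam' a"
  unfolding nu_def[of lam] using stop_nu[of lam' a] by (intro Least_le) (fastforce simp: stop_def)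

lemma nu_eq_top:
  assumes "\<And>N b. N \<le> L \<Longrightarrow> b < M L \<Longrightarrow> norm (avg N b) \<le> lam" shows "nu lam a = L"
proof (rule ccontr)
  assume "nu lam a \<noteq> L"
  then have "nu lam a < L" using nu_le[of lam a] by simp
  then obtain b where "b \<in> cls L (nu lam a) a" "lam < norm (avg (Suc (nu lam a)) b)"
    using stop_nu[of lam a] by (auto simp: stop_def)
  with assms[of "Suc (nu lam a)" b] \<open>nu lam a < L\<close> show False by (auto simp: cls_def)
qed

text \<open>Not having stopped one level earlier means that no average of the present level in that
  class exceeds \<open>lam\<close>. Level 0 has no predecessor, hence the assumption on the total
  mean.\<close>

lemma norm_avg_nu_le:
  assumes "norm (avg 0 0) \<le> lam" "a < M L" shows "norm (avg (nu lam a) a) \<le> lam"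
proof (cases "nu lam a")
  case 0
  then show ?thesis using assms(1) avg_cong[of a 0 0] by simp
next
  case (Suc n)
  then have "\<not> stop lam n a" by (intro not_stop) simp
  moreover have "a \<in> cls L n a" using assms(2) by (simp add: cls_def)
  ultimately show ?thesis unfolding Suc stop_def by auto
qed

lemma nu_in_stopped:
  assumes "d \<in> stopped lam N" "t \<in> cls L N d" shows "nu lam t = N"
  using assms nu_cong[of t lam d] by (auto simp: stopped_def cls_def)

text \<open>The classes on which the process stops partition the finite model;
  \<open>stopped\<close> lists one representative of each.\<close>

lemma sum_stopped:
  fixes h :: "nat \<Rightarrow> 'b::comm_monoid_add"
  shows "(\<Sum>t<M L. h t) = (\<Sum>N\<le>L. \<Sum>d\<in>stopped lam N. \<Sum>t\<in>cls L N d. h t)"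
proof -
  have "(\<Sum>t<M L. h t) = (\<Sum>N\<le>L. sum h {t \<in> {..<M L}. nu lam t = N})"
    by (rule sum.group[symmetric]) (auto simp: nu_le)
  also have "\<dots> = (\<Sum>N\<le>L. \<Sum>d\<in>stopped lam N. \<Sum>t\<in>cls L N d. h t)"
  proof (rule sum.cong[OF refl])
    fix N
    let ?S = "{t \<in> {..<M L}. nu lam t = N}"
    have "sum h ?S = (\<Sum>d\<in>stopped lam N. sum h {t \<in> ?S. t mod M N = d})"
    proof (rule sum.group[symmetric])
      have "nu lam (t mod M N) = N" if "nu lam t = N" for t
        using nu_cong[of "t mod M N" lam t] that by simp
      then show "(\<lambda>t. t mod M N) ` ?S \<subseteq> stopped lam N" by (auto simp: stopped_def)
    qed simp_all
    also have "\<dots> = (\<Sum>d\<in>stopped lam N. \<Sum>t\<in>cls L N d. h t)"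
    proof (rule sum.cong[OF refl], rule sum.cong[OF _ refl])
      fix d assume d: "d \<in> stopped lam N"
      then show "{t \<in> ?S. t mod M N = d} = cls L N d"
        using nu_in_stopped[OF d] by (auto simp: cls_def stopped_def)
    qed
    finally show "sum h ?S = (\<Sum>d\<in>stopped lam N. \<Sum>t\<in>cls L N d. h t)" .
  qed
  finally show ?thesis .
qed

lemma sum_cls_avg:
  assumes "N \<le> L" shows "(\<Sum>t\<in>cls L N d. avg N t) = (\<Sum>t\<in>cls L N d. F t)"
proof -
  have "(\<Sum>t\<in>cls L N d. avg N t) = (\<Sum>t\<in>cls L N d. avg N d)"
    by (intro sum.cong refl avg_cong) (simp add: cls_def)
  also have "\<dots> = of_real (real (card (cls L N d))) * avg N d" by simp
  also have "\<dots> = (\<Sum>t\<in>cls L N d. F t)"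
    unfolding card_cls[OF assms] avg_def by simp
  finally show ?thesis .
qed

text \<open>Optional stopping. With \<open>chi\<close> the indicator of the class of
  \<open>c\<close>, each stopped class of level \<open>K \<ge> N\<close> lies inside or outside that
  class, and averaging on it preserves the sum of \<open>F\<close>; those with \<open>K < N\<close>
  miss it by assumption.\<close>

lemma sum_cls_avg_nu:
  assumes ge: "\<And>t. t \<in> cls L N c \<Longrightarrow> N \<le> nu lam t"
  shows "(\<Sum>t\<in>cls L N c. avg (nu lam t) t) = (\<Sum>t\<in>cls L N c. F t)"
proof -
  define chi :: "nat \<Rightarrow> complex" where "chi t = (if t mod M N = c mod M N then 1 else 0)" for t
  have sum_chi: "(\<Sum>t\<in>cls L N c. g t) = (\<Sum>t<M L. chi t * g t)" for g
    by (intro sum.mono_neutral_cong_left) (auto simp: cls_def chi_def)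
  have "(\<Sum>t<M L. chi t * avg (nu lam t) t) =
    (\<Sum>K\<le>L. \<Sum>d\<in>stopped lam K. \<Sum>t\<in>cls L K d. chi t * avg (nu lam t) t)"
    by (rule sum_stopped)
  also have "\<dots> = (\<Sum>K\<le>L. \<Sum>d\<in>stopped lam K. \<Sum>t\<in>cls L K d. chi t * F t)"
  proof (rule sum.cong[OF refl], rule sum.cong[OF refl])
    fix K d assume K: "K \<in> {..L}" and d: "d \<in> stopped lam K"
    show "(\<Sum>t\<in>cls L K d. chi t * avg (nu lam t) t) = (\<Sum>t\<in>cls L K d. chi t * F t)"
    proof (cases "N \<le> K")
      case True
      have chi: "chi t = chi d" if "t \<in> cls L K d" for t
        using that mod_eq_mono[of t K d N] True by (simp add: cls_def chi_def)
      then have *: "(\<Sum>t\<in>cls L K d. chi t * g t) = chi d * (\<Sum>t\<in>cls L K d. g t)" for g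
        unfolding sum_distrib_left by (intro sum.cong refl arg_cong[where f = "\<lambda>x. x * g _"] chi)
      have "(\<Sum>t\<in>cls L K d. avg (nu lam t) t) = (\<Sum>t\<in>cls L K d. avg K t)"
        using nu_in_stopped[OF d] by (intro sum.cong refl) simp
      also have "\<dots> = (\<Sum>t\<in>cls L K d. F t)" using K by (intro sum_cls_avg) simp
      finally show ?thesis unfolding * by simp
    next
      case False
      have chi: "chi t = 0" if t: "t \<in> cls L K d" for t
      proof (rule ccontr)
        assume "chi t \<noteq> 0"
        then have "t \<in> cls L N c" using t by (auto simp: cls_def chi_def split: if_splits)
        with ge nu_in_stopped[OF d t] False show False by auto
      qed
      show ?thesis by (intro sum.cong refl) (simp add: chi)
    qed
  qed
  also have "\<dots> = (\<Sum>t<M L. chi t * F t)" by (rule sum_stopped[symmetric])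
  finally show ?thesis unfolding sum_chi .
qed

text \<open>
  Regularity of the filtration: a stopped class contains a class of the next level, which makes up
  at least the fraction \<open>1 / R\<close> of it and on which the maximal function is large.
\<close>

lemma sum_stopped_measure_le:
  "(\<Sum>N<L. \<Sum>d\<in>stopped lam N. real (M L) / real (M N)) \<le> R * (\<Sum>t<M L. of_bool (lam < max_avg t))"
proof -
  have "(\<Sum>N<L. \<Sum>d\<in>stopped lam N. real (M L) / real (M N)) \<le>
    (\<Sum>N<L. \<Sum>d\<in>stopped lam N. R * (\<Sum>t\<in>cls L N d. of_bool (lam < max_avg t)))"
  proof (intro sum_mono)
    fix N d assume N: "N \<in> {..<L}" and d: "d \<in> stopped lam N"
    then have "nu lam d = N" by (simp add: stopped_def)
    with stop_nu[of lam d] N obtain b where b: "b \<in> cls L N d" "lam < norm (avg (Suc N) b)"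
      by (auto simp: stop_def)
    have sub: "cls L (Suc N) b \<subseteq> cls L N d"
    proof
      fix t assume t: "t \<in> cls L (Suc N) b"
      then have "t mod M N = b mod M N"
        by (intro mod_eq_mono[of t "Suc N" b N]) (simp_all add: cls_def del: gen_power.simps)
      then show "t \<in> cls L N d" using t b(1) unfolding cls_def by simp
    qed
    have large: "lam < max_avg t" if "t \<in> cls L (Suc N) b" for t
    proof -
      have "avg (Suc N) t = avg (Suc N) b"
        using that by (intro avg_cong) (simp add: cls_def del: gen_power.simps)
      then show ?thesis using norm_avg_le_max[of "Suc N" t] b(2) N by simp
    qed
    have 1: "real (M L) / real (M N) \<le> R * (real (M L) / real (M (Suc N)))"
    proof -
      have "1 \<le> R / real (m N)" using m_le[of N] m_ge_2[of N] by (simp add: pos_le_divide_eq)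
      then have "real (M L) / real (M N) * 1 \<le> real (M L) / real (M N) * (R / real (m N))"
        by (intro mult_left_mono) auto
      then show ?thesis by (simp add: mult_ac)
    qed
    have "real (M L) / real (M (Suc N)) = (\<Sum>t\<in>cls L (Suc N) b. of_bool (lam < max_avg t))"
    proof -
      have "(\<Sum>t\<in>cls L (Suc N) b. of_bool (lam < max_avg t)) = (\<Sum>t\<in>cls L (Suc N) b. 1 :: real)"
        using large by (intro sum.cong refl) simp
      also have "\<dots> = real (card (cls L (Suc N) b))" by simp
      also have "\<dots> = real (M L) / real (M (Suc N))" using N by (intro card_cls) simp
      finally show ?thesis ..
    qed
    also have "\<dots> \<le> (\<Sum>t\<in>cls L N d. of_bool (lam < max_avg t))"
      using sub by (intro sum_mono2) simp_all
    finally have "R * (real (M L) / real (M (Suc N))) \<le> R * (\<Sum>t\<in>cls L N d. of_bool (lam < max_avg t))"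
      using R_ge_2 by (intro mult_left_mono) auto
    with 1 show "real (M L) / real (M N) \<le> R * (\<Sum>t\<in>cls L N d. of_bool (lam < max_avg t))"
      by (rule order_trans)
  qed
  also have "\<dots> \<le> (\<Sum>N\<le>L. \<Sum>d\<in>stopped lam N. R * (\<Sum>t\<in>cls L N d. of_bool (lam < max_avg t)))"
    using R_ge_2 by (intro sum_mono2 sum_nonneg mult_nonneg_nonneg) auto
  also have "\<dots> = R * (\<Sum>t<M L. of_bool (lam < max_avg t))"
    unfolding sum_stopped[of "\<lambda>t. of_bool (lam < max_avg t)" lam] sum_distrib_left ..
  finally show ?thesis .
qed

section \<open>Atomic decomposition and the majorant\<close>

text \<open>On a class stopped by \<open>lam\<close> at level \<open>N\<close>, the difference is
  bounded by \<open>lam' + lam\<close> and has sum zero, since both stopped averages preserve the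
  sum of \<open>F\<close>: it is an atom. Classes stopped at level \<open>L\<close> contribute
  nothing, because \<open>lam'\<close> stops there too.\<close>

lemma norm_sum_stopped_difference_le:
  assumes n: "1 \<le> n" "n \<le> M L" and lam: "norm (avg 0 0) \<le> lam" "lam \<le> lam'" "0 \<le> lam"
  shows "norm (\<Sum>t<M L. (avg (nu lam' t) t - avg (nu lam t) t) * fejer_sum (pt a) (pt t) (Suc n)) \<le>
    real (M L) * (\<Sum>N<L. \<Sum>d\<in>stopped lam N. (lam' + lam) * atom_bound N d a) *
      (real n * (ln (real n + 1))\<^sup>2)"
proof -
  let ?g = "real n * (ln (real n + 1))\<^sup>2"
  let ?b = "\<lambda>t. avg (nu lam' t) t - avg (nu lam t) t"
  let ?K = "\<lambda>t. fejer_sum (pt a) (pt t) (Suc n)"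
  have "{..L} = insert L {..<L}" by auto
  then have "(\<Sum>t<M L. ?b t * ?K t) = (\<Sum>d\<in>stopped lam L. \<Sum>t\<in>cls L L d. ?b t * ?K t) +
      (\<Sum>N<L. \<Sum>d\<in>stopped lam N. \<Sum>t\<in>cls L N d. ?b t * ?K t)"
    unfolding sum_stopped[of "\<lambda>t. ?b t * ?K t" lam] by simp
  also have "(\<Sum>d\<in>stopped lam L. \<Sum>t\<in>cls L L d. ?b t * ?K t) = 0"
  proof (intro sum.neutral ballI)
    fix d t assume "d \<in> stopped lam L" "t \<in> cls L L d"
    then have "nu lam t = L" by (rule nu_in_stopped)
    moreover have "nu lam' t = L" using nu_mono[OF lam(2), of t] nu_le[of lam' t] calculation by simp
    ultimately show "?b t * ?K t = 0" by simp
  qed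
  finally have "norm (\<Sum>t<M L. ?b t * ?K t) =
      norm (\<Sum>N<L. \<Sum>d\<in>stopped lam N. \<Sum>t\<in>cls L N d. ?b t * ?K t)"
    by simp
  also have "\<dots> \<le> (\<Sum>N<L. \<Sum>d\<in>stopped lam N. real (M L) * (lam' + lam) * atom_bound N d a * ?g)"
  proof (intro sum_norm_le)
    fix N d assume N: "N \<in> {..<L}" and d: "d \<in> stopped lam N"
    show "norm (\<Sum>t\<in>cls L N d. ?b t * ?K t) \<le> real (M L) * (lam' + lam) * atom_bound N d a * ?g"
    proof (rule norm_sum_fejer_sum_atom_le[OF n])
      fix t assume t: "t \<in> cls L N d"
      then have "t < M L" by (simp add: cls_def)
      have "norm (?b t) \<le> norm (avg (nu lam' t) t) + norm (avg (nu lam t) t)"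
        by (rule norm_triangle_ineq4)
      also have "\<dots> \<le> lam' + lam"
        using lam \<open>t < M L\<close> by (intro add_mono norm_avg_nu_le) auto
      finally show "norm (?b t) \<le> lam' + lam" .
    next
      have nu: "N \<le> nu lam t" "N \<le> nu lam' t" if "t \<in> cls L N d" for t
        using nu_in_stopped[OF d that] nu_mono[OF lam(2), of t] by auto
      show "(\<Sum>t\<in>cls L N d. ?b t) = 0"
        unfolding sum_subtractf using nu by (simp add: sum_cls_avg_nu)
    qed (use N lam in auto)
  qed
  also have "\<dots> = real (M L) * (\<Sum>N<L. \<Sum>d\<in>stopped lam N. (lam' + lam) * atom_bound N d a) * ?g"
    unfolding sum_distrib_left sum_distrib_right by (simp only: mult.assoc)
  finally show ?thesis .
qed

text \<open>One function \<open>W\<close> serves all \<open>n\<close>, which is what a maximal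
  operator requires. The summand \<open>eps\<close> keeps the lowest level positive even when
  \<open>F\<close> has mean zero.\<close>

lemma exists_majorant_aux:
  assumes eps: "0 < eps"
  obtains W where "\<And>a. 0 \<le> W a"
    and "\<And>n a. 1 \<le> n \<Longrightarrow> n \<le> M L \<Longrightarrow>
      norm (\<Sum>t<M L. F t * fejer_sum (pt a) (pt t) (Suc n)) \<le>
        real (M L) * W a * (real n * (ln (real n + 1))\<^sup>2)"
    and "(\<Sum>a<M L. sqrt (W a)) \<le> real (M L) * sqrt lebesgue_const * sqrt (norm (avg 0 0) + eps) +
      2 * sqrt 5 * atom_const * R * (\<Sum>a<M L. sqrt (max_avg a))"
proof -
  \<comment> \<open>The ratio 4 makes the roots of the levels grow dyadically; starting above the
    total mean makes \<open>norm_avg_nu_le\<close> applicable at every level.\<close>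
  define lam where "lam i = 4 ^ i * (norm (avg 0 0) + eps)" for i :: nat
  have lam0: "0 < norm (avg 0 0) + eps" using eps by (simp add: add_nonneg_pos)
  have lam_Suc: "lam (Suc i) = 4 * lam i" for i by (simp add: lam_def)
  have lam_pos: "0 < lam i" for i using lam0 by (simp add: lam_def)
  have lam_ge: "norm (avg 0 0) \<le> lam i" for i
  proof -
    have "1 * norm (avg 0 0) \<le> 4 ^ i * (norm (avg 0 0) + eps)"
      using eps by (intro mult_mono) auto
    then show ?thesis by (simp add: lam_def)
  qed
  have sqrt_lam: "sqrt (lam i) = 2 ^ i * sqrt (lam 0)" for i
  proof -
    have "sqrt (4 ^ i) = (2::real) ^ i" by (simp add: real_sqrt_power)
    then show ?thesis by (simp add: lam_def real_sqrt_mult)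
  qed
  \<comment> \<open>Some level exceeds the maximum of the finite maximal function. From there on the
    stopped average is \<open>F\<close> itself, so the telescoping sum is finite.\<close>
  obtain I where I: "nu (lam I) t = L" for t
  proof -
    define B where "B = Max (max_avg ` {..<M L})"
    have B: "max_avg b \<le> B" if "b < M L" for b
      unfolding B_def using that by (intro Max_ge) auto
    obtain I where "B / lam 0 < 4 ^ I" using real_arch_pow[of 4 "B / lam 0"] by auto
    then have "B < lam I" using lam_pos[of 0] by (simp add: pos_divide_less_eq lam_def)
    have "nu (lam I) t = L" for t
    proof (rule nu_eq_top)
      fix N b assume "N \<le> L" "b < M L"
      then show "norm (avg N b) \<le> lam I"
        using norm_avg_le_max[of N b] B[of b] \<open>B < lam I\<close> by linarith
    qed
    then show ?thesis using that by blast
  qed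
  let ?f = "\<lambda>i t. avg (nu (lam i) t) t"
  define A where "A i a = (\<Sum>N<L. \<Sum>d\<in>stopped (lam i) N. 5 * lam i * atom_bound N d a)" for i a
  define W where "W a = lebesgue_const * lam 0 + (\<Sum>i<I. A i a)" for a
  have A_nonneg: "0 \<le> 5 * lam i * atom_bound N d a" for i N d a
    using lam_pos[of i] atom_bound_nonneg[of N d a] by simp
  have A_sum_nonneg: "0 \<le> A i a" for i a
    unfolding A_def by (intro sum_nonneg A_nonneg)
  show thesis
  proof
    show "0 \<le> W a" for a
      unfolding W_def using lebesgue_const_nonneg lam_pos[of 0]
      by (intro add_nonneg_nonneg sum_nonneg A_sum_nonneg) auto
  next
    fix n a assume n: "1 \<le> n" "n \<le> M L"
    let ?K = "\<lambda>t. fejer_sum (pt a) (pt t) (Suc n)"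
    let ?g = "real n * (ln (real n + 1))\<^sup>2"
    have telescope: "F t = ?f 0 t + (\<Sum>i<I. ?f (Suc i) t - ?f i t)" if "t < M L" for t
      using sum_lessThan_telescope[of "\<lambda>i. ?f i t" I] avg_top[OF that] I[of t] by simp
    have "(\<Sum>t<M L. F t * ?K t) = (\<Sum>t<M L. (?f 0 t + (\<Sum>i<I. ?f (Suc i) t - ?f i t)) * ?K t)"
    proof (rule sum.cong[OF refl])
      fix t assume "t \<in> {..<M L}"
      then have "t < M L" by simp
      from telescope[OF this] show "F t * ?K t = (?f 0 t + (\<Sum>i<I. ?f (Suc i) t - ?f i t)) * ?K t"
        by (rule arg_cong)
    qed
    also have "\<dots> = (\<Sum>t<M L. ?f 0 t * ?K t) + (\<Sum>i<I. \<Sum>t<M L. (?f (Suc i) t - ?f i t) * ?K t)"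
      unfolding distrib_right sum.distrib sum_distrib_right
      by (subst sum.swap) (rule refl)
    finally have "norm (\<Sum>t<M L. F t * ?K t) = norm ((\<Sum>t<M L. ?f 0 t * ?K t) +
        (\<Sum>i<I. \<Sum>t<M L. (?f (Suc i) t - ?f i t) * ?K t))"
      by (rule arg_cong)
    also have "\<dots> \<le> norm (\<Sum>t<M L. ?f 0 t * ?K t) + norm (\<Sum>i<I. \<Sum>t<M L. (?f (Suc i) t - ?f i t) * ?K t)"
      by (rule norm_triangle_ineq)
    also have "\<dots> \<le> norm (\<Sum>t<M L. ?f 0 t * ?K t) + (\<Sum>i<I. norm (\<Sum>t<M L. (?f (Suc i) t - ?f i t) * ?K t))"
      by (rule add_left_mono) (rule norm_sum)
    also have "\<dots> \<le> real (M L) * lam 0 * lebesgue_const * ?g + (\<Sum>i<I. real (M L) * A i a * ?g)"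
    proof (intro add_mono sum_mono)
      show "norm (\<Sum>t<M L. ?f 0 t * ?K t) \<le> real (M L) * lam 0 * lebesgue_const * ?g"
      proof (rule norm_sum_fejer_sum_const_le[OF n subset_refl])
        show "norm (?f 0 t) \<le> lam 0" if "t \<in> {..<M L}" for t
          using that by (intro norm_avg_nu_le lam_ge) auto
      qed (use lam_pos[of 0] in simp)
    next
      fix i
      have "lam i \<le> lam (Suc i)" "0 \<le> lam i" "lam (Suc i) + lam i = 5 * lam i"
        using lam_pos[of i] by (auto simp: lam_Suc)
      then show "norm (\<Sum>t<M L. (?f (Suc i) t - ?f i t) * ?K t) \<le> real (M L) * A i a * ?g"
        using norm_sum_stopped_difference_le[OF n lam_ge, of i "lam (Suc i)" a] by (simp add: A_def)
    qed
    also have "\<dots> = real (M L) * W a * ?g"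
      unfolding W_def distrib_left distrib_right sum_distrib_left sum_distrib_right
      by (simp only: mult_ac)
    finally show "norm (\<Sum>t<M L. F t * ?K t) \<le> real (M L) * W a * ?g" .
  next
    let ?X = "\<Sum>a<M L. sqrt (max_avg a)"
    have "sqrt (W a) \<le> sqrt lebesgue_const * sqrt (lam 0) +
        (\<Sum>i<I. \<Sum>N<L. \<Sum>d\<in>stopped (lam i) N. sqrt 5 * sqrt (lam i) * sqrt (atom_bound N d a))" for a
    proof -
      have "sqrt (W a) \<le> sqrt (lebesgue_const * lam 0) + sqrt (\<Sum>i<I. A i a)"
        unfolding W_def using lebesgue_const_nonneg lam_pos[of 0]
        by (intro sqrt_add_le sum_nonneg A_sum_nonneg) auto
      moreover have "sqrt (\<Sum>i<I. A i a) \<le> (\<Sum>i<I. sqrt (A i a))"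
        by (intro sqrt_sum_le A_sum_nonneg)
      moreover have "\<dots> \<le> (\<Sum>i<I. \<Sum>N<L. sqrt (\<Sum>d\<in>stopped (lam i) N. 5 * lam i * atom_bound N d a))"
        unfolding A_def by (intro sum_mono sqrt_sum_le sum_nonneg A_nonneg)
      moreover have "\<dots> \<le> (\<Sum>i<I. \<Sum>N<L. \<Sum>d\<in>stopped (lam i) N. sqrt (5 * lam i * atom_bound N d a))"
        by (intro sum_mono sqrt_sum_le A_nonneg)
      ultimately show ?thesis unfolding real_sqrt_mult by linarith
    qed
    then have "(\<Sum>a<M L. sqrt (W a)) \<le> (\<Sum>a<M L. sqrt lebesgue_const * sqrt (lam 0) +
        (\<Sum>i<I. \<Sum>N<L. \<Sum>d\<in>stopped (lam i) N. sqrt 5 * sqrt (lam i) * sqrt (atom_bound N d a)))"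
      by (rule sum_mono)
    also have "\<dots> = real (M L) * sqrt lebesgue_const * sqrt (lam 0) +
        (\<Sum>i<I. \<Sum>a<M L. \<Sum>N<L. \<Sum>d\<in>stopped (lam i) N. sqrt 5 * sqrt (lam i) * sqrt (atom_bound N d a))"
      unfolding sum.distrib by (subst sum.swap) simp
    also have "(\<Sum>i<I. \<Sum>a<M L. \<Sum>N<L. \<Sum>d\<in>stopped (lam i) N. sqrt 5 * sqrt (lam i) * sqrt (atom_bound N d a)) =
        (\<Sum>i<I. \<Sum>N<L. \<Sum>d\<in>stopped (lam i) N. sqrt 5 * sqrt (lam i) * (\<Sum>a<M L. sqrt (atom_bound N d a)))"
    proof (rule sum.cong[OF refl])
      fix i
      show "(\<Sum>a<M L. \<Sum>N<L. \<Sum>d\<in>stopped (lam i) N. sqrt 5 * sqrt (lam i) * sqrt (atom_bound N d a)) =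
        (\<Sum>N<L. \<Sum>d\<in>stopped (lam i) N. sqrt 5 * sqrt (lam i) * (\<Sum>a<M L. sqrt (atom_bound N d a)))"
        unfolding sum_distrib_left
        by (subst sum.swap, rule sum.cong[OF refl], subst sum.swap) (rule refl)
    qed
    \<comment> \<open>Each atom costs a multiple of the size of its support, and by regularity the
      supports at level \<open>lam i\<close> together are at most \<open>R\<close> times as large as
      the set where the maximal function exceeds \<open>lam i\<close>.\<close>
    also have "\<dots> \<le> (\<Sum>i<I. sqrt 5 * sqrt (lam i) * (atom_const * (R * (\<Sum>a<M L. of_bool (lam i < max_avg a)))))"
    proof (intro sum_mono)
      fix i
      have c: "0 \<le> atom_const" using lebesgue_const_nonneg by (simp add: atom_const_def)
      have "(\<Sum>N<L. \<Sum>d\<in>stopped (lam i) N. sqrt 5 * sqrt (lam i) * (\<Sum>a<M L. sqrt (atom_bound N d a))) \<le>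
          (\<Sum>N<L. \<Sum>d\<in>stopped (lam i) N. sqrt 5 * sqrt (lam i) * (atom_const * (real (M L) / real (M N))))"
        using lam_pos[of i] by (intro sum_mono mult_left_mono sum_sqrt_atom_bound_le) auto
      also have "\<dots> = sqrt 5 * sqrt (lam i) * (atom_const * (\<Sum>N<L. \<Sum>d\<in>stopped (lam i) N. real (M L) / real (M N)))"
        unfolding sum_distrib_left ..
      also have "\<dots> \<le> sqrt 5 * sqrt (lam i) * (atom_const * (R * (\<Sum>a<M L. of_bool (lam i < max_avg a))))"
        using lam_pos[of i] c by (intro mult_left_mono sum_stopped_measure_le) auto
      finally show "(\<Sum>N<L. \<Sum>d\<in>stopped (lam i) N. sqrt 5 * sqrt (lam i) * (\<Sum>a<M L. sqrt (atom_bound N d a))) \<le>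
        sqrt 5 * sqrt (lam i) * (atom_const * (R * (\<Sum>a<M L. of_bool (lam i < max_avg a))))" .
    qed
    also have "\<dots> = sqrt 5 * atom_const * R * (\<Sum>i<I. \<Sum>a<M L. sqrt (lam i) * of_bool (lam i < max_avg a))"
      unfolding sum_distrib_left by (simp only: mult_ac)
    also have "\<dots> = sqrt 5 * atom_const * R * (\<Sum>a<M L. \<Sum>i<I. 2 ^ i * sqrt (lam 0) *
        of_bool (2 ^ i * sqrt (lam 0) < sqrt (max_avg a)))"
      by (subst sum.swap) (simp only: sqrt_lam[symmetric] real_sqrt_less_iff)
    also have "\<dots> \<le> sqrt 5 * atom_const * R * (\<Sum>a<M L. 2 * sqrt (max_avg a))"
    proof (intro mult_left_mono sum_mono sum_dyadic_le)
      show "0 \<le> sqrt 5 * atom_const * R"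
        using R_ge_2 lebesgue_const_nonneg by (simp add: atom_const_def)
    qed (use lam_pos[of 0] max_avg_nonneg in auto)
    also have "sqrt 5 * atom_const * R * (\<Sum>a<M L. 2 * sqrt (max_avg a)) = 2 * sqrt 5 * atom_const * R * ?X"
      unfolding sum_distrib_left[symmetric] by simp
    also have "lam 0 = norm (avg 0 0) + eps" by (simp add: lam_def)
    finally show "(\<Sum>a<M L. sqrt (W a)) \<le> real (M L) * sqrt lebesgue_const * sqrt (norm (avg 0 0) + eps) +
      2 * sqrt 5 * atom_const * R * ?X"
      by simp
  qed
qed

text \<open>The parameter \<open>eps\<close> is chosen so that \<open>M L * sqrt eps = X\<close>;
  together with \<open>norm (avg 0 0) \<le> max_avg a\<close> this bounds the term of the lowest
  level by a multiple of \<open>2 * X\<close>. If \<open>X = 0\<close>, then \<open>F\<close>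
  vanishes and so may \<open>W\<close>.\<close>

lemma exists_majorant:
  obtains W where "\<And>a. 0 \<le> W a"
    and "\<And>n a. 1 \<le> n \<Longrightarrow> n \<le> M L \<Longrightarrow>
      norm (\<Sum>t<M L. F t * fejer_sum (pt a) (pt t) (Suc n)) \<le>
        real (M L) * W a * (real n * (ln (real n + 1))\<^sup>2)"
    and "(\<Sum>a<M L. sqrt (W a)) \<le> hardy_const * (\<Sum>a<M L. sqrt (max_avg a))"
proof -
  define X where "X = (\<Sum>a<M L. sqrt (max_avg a))"
  have X_nonneg: "0 \<le> X" unfolding X_def by (intro sum_nonneg) (simp add: max_avg_nonneg)
  show thesis
  proof (cases "X = 0")
    case True
    then have "sqrt (max_avg t) = 0" if "t < M L" for t
      using that sum_nonneg_eq_0_iff[of "{..<M L}" "\<lambda>a. sqrt (max_avg a)"]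
      by (simp add: X_def max_avg_nonneg)
    then have "F t = 0" if "t < M L" for t
      using that norm_avg_le_max[of L t] avg_top[of t] by simp
    then show ?thesis using that[of "\<lambda>_. 0"] X_nonneg True by (simp add: X_def)
  next
    case False
    with X_nonneg have X: "0 < X" by simp
    let ?eps = "(X / real (M L))\<^sup>2"
    have eps: "0 < ?eps" using X by simp
    show ?thesis
    proof (rule exists_majorant_aux[OF eps])
      fix W
      assume W: "\<And>a. 0 \<le> W a"
        "\<And>n a. 1 \<le> n \<Longrightarrow> n \<le> M L \<Longrightarrow>
          norm (\<Sum>t<M L. F t * fejer_sum (pt a) (pt t) (Suc n)) \<le>
            real (M L) * W a * (real n * (ln (real n + 1))\<^sup>2)"
        "(\<Sum>a<M L. sqrt (W a)) \<le> real (M L) * sqrt lebesgue_const * sqrt (norm (avg 0 0) + ?eps) +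
          2 * sqrt 5 * atom_const * R * (\<Sum>a<M L. sqrt (max_avg a))"
      note W3 = W(3)[folded X_def]
      have "sqrt (norm (avg 0 0) + ?eps) \<le> sqrt (norm (avg 0 0)) + sqrt ?eps"
        by (rule sqrt_add_le) auto
      then have "real (M L) * sqrt (norm (avg 0 0) + ?eps) \<le>
          real (M L) * (sqrt (norm (avg 0 0)) + X / real (M L))"
        using X by (intro mult_left_mono) auto
      also have "\<dots> = (\<Sum>a<M L. sqrt (norm (avg 0 0))) + X"
        by (simp add: distrib_left)
      finally have 1: "real (M L) * sqrt (norm (avg 0 0) + ?eps) \<le> (\<Sum>a<M L. sqrt (norm (avg 0 0))) + X" .
      have "norm (avg 0 0) \<le> max_avg a" for a
        using norm_avg_le_max[of 0 a] avg_cong[of a 0 0] by simp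
      then have 2: "(\<Sum>a<M L. sqrt (norm (avg 0 0))) \<le> X"
        unfolding X_def by (intro sum_mono real_sqrt_le_mono)
      have "sqrt lebesgue_const * (real (M L) * sqrt (norm (avg 0 0) + ?eps)) \<le> sqrt lebesgue_const * (X + X)"
        using 1 2 lebesgue_const_nonneg by (intro mult_left_mono) auto
      moreover have "hardy_const * X = sqrt lebesgue_const * (X + X) + 2 * sqrt 5 * atom_const * R * X"
        by (simp add: hardy_const_def algebra_simps)
      ultimately have "(\<Sum>a<M L. sqrt (W a)) \<le> hardy_const * X"
        using W3 unfolding mult.assoc[of "real (M L)"] mult.left_commute[of "real (M L)" "sqrt lebesgue_const"]
        by linarith
      then show ?thesis using that[OF W(1,2)] by (simp add: X_def)
    qed
  qed
qed

end

subsection \<open>Cylinder functions\<close>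

text \<open>On the group, this inverts \<open>pt\<close> as far as the first \<open>L\<close>
  coordinates are concerned.\<close>

definition code :: "nat \<Rightarrow> (nat \<Rightarrow> nat) \<Rightarrow> nat" where
  "code L x = (\<Sum>j<L. x j * M j)"

lemma group_less: "x \<in> vilenkin_group m \<Longrightarrow> x j < m j"
  by (auto simp: vilenkin_group_def PiE_iff)

lemma code_less:
  assumes "x \<in> vilenkin_group m" shows "code L x < M L"
proof (induction L)
  case (Suc l)
  have "Suc (x l) * M l \<le> m l * M l"
    using group_less[OF assms, of l] by (intro mult_right_mono) auto
  with Suc show ?case by (simp add: code_def)
qed (simp add: code_def)

lemma digit_code:
  assumes "x \<in> vilenkin_group m" "j < L" shows "digit m (code L x) j = x j"
  using digit_unique[of m x "code L x" L j] m_ge_2 group_less[OF assms(1)] assms(2)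
  by (simp add: code_def)

lemma code_eq_iff:
  assumes "x \<in> vilenkin_group m" "a < M L"
  shows "code L x = a \<longleftrightarrow> (\<forall>j<L. x j = digit m a j)"
proof
  assume "\<forall>j<L. x j = digit m a j"
  then have "code L x mod M L = a mod M L"
    unfolding mod_eq_iff_digits using digit_code[OF assms(1)] by simp
  then show "code L x = a" using code_less[OF assms(1)] assms(2) by simp
qed (use digit_code[OF assms(1)] in auto)

lemma emeasure_code_vimage:
  assumes "a < M L"
  shows "{x \<in> vilenkin_group m. code L x = a} \<in> sets (haar m)"
    and "emeasure (haar m) {x \<in> vilenkin_group m. code L x = a} = ennreal (1 / real (M L))"
proof -
  let ?U = "\<lambda>k. uniform_count_measure {..<m k}"
  interpret product_prob_space ?U UNIV by (rule product_prob_space_uniform[OF m_ge_2])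
  have m_pos: "0 < real (m j)" for j using m_ge_2[of j] by simp
  have eq: "{x \<in> vilenkin_group m. code L x = a} =
      prod_emb UNIV ?U {..<L} (Pi\<^sub>E {..<L} (\<lambda>j. {digit m a j}))"
  proof (rule set_eqI)
    fix x
    have "x \<in> {x \<in> vilenkin_group m. code L x = a} \<longleftrightarrow> x \<in> vilenkin_group m \<and> (\<forall>j<L. x j = digit m a j)"
      using code_eq_iff[of x a L] assms by auto
    also have "\<dots> \<longleftrightarrow> x \<in> prod_emb UNIV ?U {..<L} (Pi\<^sub>E {..<L} (\<lambda>j. {digit m a j}))"
      by (auto simp: prod_emb_def space_uniform_count_measure vilenkin_group_def PiE_iff)
    finally show "x \<in> {x \<in> vilenkin_group m. code L x = a} \<longleftrightarrow>
      x \<in> prod_emb UNIV ?U {..<L} (Pi\<^sub>E {..<L} (\<lambda>j. {digit m a j}))" .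
  qed
  have sets: "{digit m a j} \<in> sets (?U j)" for j
    by (simp add: sets_uniform_count_measure pt_less)
  show "{x \<in> vilenkin_group m. code L x = a} \<in> sets (haar m)"
    unfolding eq haar_def by (intro sets_PiM_I) (simp_all add: sets)
  have "emeasure (haar m) {x \<in> vilenkin_group m. code L x = a} = (\<Prod>j<L. emeasure (?U j) {digit m a j})"
    unfolding eq haar_def by (intro emeasure_PiM_emb) (simp_all add: sets)
  also have "\<dots> = (\<Prod>j<L. ennreal (1 / real (m j)))"
    by (intro prod.cong refl) (simp add: emeasure_uniform_count_measure pt_less)
  also have "\<dots> = ennreal (\<Prod>j<L. 1 / real (m j))"
    by (rule prod_ennreal) simp
  also have "(\<Prod>j<L. 1 / real (m j)) = 1 / real (M L)"
    by (induction L) simp_all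
  finally show "emeasure (haar m) {x \<in> vilenkin_group m. code L x = a} = ennreal (1 / real (M L))" .
qed

lemma measurable_code: "code L \<in> measurable (haar m) (count_space {..<M L})"
proof (rule measurable_count_space_eq2[THEN iffD2], simp, intro conjI ballI)
  show "code L \<in> space (haar m) \<rightarrow> {..<M L}" by (auto simp: space_haar code_less)
  fix a assume "a \<in> {..<M L}"
  then have "{x \<in> vilenkin_group m. code L x = a} \<in> sets (haar m)"
    by (intro emeasure_code_vimage) simp
  also have "{x \<in> vilenkin_group m. code L x = a} = code L -` {a} \<inter> space (haar m)"
    by (auto simp: space_haar)
  finally show "code L -` {a} \<inter> space (haar m) \<in> sets (haar m)" .
qed

text \<open>Each fibre of \<open>code L\<close> prescribes \<open>L\<close> coordinates and so has
  measure \<open>1 / M L\<close>. Integrals of functions of these coordinates thus become finite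
  averages.\<close>

lemma distr_code: "distr (haar m) (count_space {..<M L}) (code L) = uniform_count_measure {..<M L}"
proof (rule measure_eqI_finite[of _ "{..<M L}"])
  fix a assume a: "a \<in> {..<M L}"
  have "emeasure (distr (haar m) (count_space {..<M L}) (code L)) {a} =
      emeasure (haar m) (code L -` {a} \<inter> space (haar m))"
    using a by (intro emeasure_distr measurable_code) auto
  also have "code L -` {a} \<inter> space (haar m) = {x \<in> vilenkin_group m. code L x = a}"
    by (auto simp: space_haar)
  also have "emeasure (haar m) \<dots> = emeasure (uniform_count_measure {..<M L}) {a}"
    using a by (simp add: emeasure_code_vimage emeasure_uniform_count_measure)
  finally show "emeasure (distr (haar m) (count_space {..<M L}) (code L)) {a} =
      emeasure (uniform_count_measure {..<M L}) {a}" .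
qed (auto simp: sets_uniform_count_measure)

definition cylinder_fun :: "nat \<Rightarrow> ((nat \<Rightarrow> nat) \<Rightarrow> 'b) \<Rightarrow> bool" where
  "cylinder_fun L h \<longleftrightarrow> (\<forall>x\<in>vilenkin_group m. \<forall>y\<in>vilenkin_group m. (\<forall>j<L. x j = y j) \<longrightarrow> h x = h y)"

lemma cylinder_fun_code:
  assumes "cylinder_fun N h" "N \<le> L" "x \<in> vilenkin_group m" shows "h x = h (pt (code L x))"
proof -
  have "x j = pt (code L x) j" if "j < N" for j
    using digit_code[OF assms(3), of j L] that assms(2) by simp
  then show ?thesis
    using assms(1,3) pt_in_group[of "code L x"] unfolding cylinder_fun_def by blast
qed

lemma measurable_cylinder_fun:
  assumes "cylinder_fun L h" "\<And>x. h x \<in> space K" shows "h \<in> measurable (haar m) K"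
proof -
  have "(\<lambda>a. h (pt a)) \<in> measurable (count_space {..<M L}) K"
    using assms(2) by (auto simp: measurable_def)
  then have "(\<lambda>x. h (pt (code L x))) \<in> measurable (haar m) K"
    by (rule measurable_compose[OF measurable_code])
  then show ?thesis
    by (subst measurable_cong[of _ _ "\<lambda>x. h (pt (code L x))"])
      (auto simp: space_haar cylinder_fun_code[OF assms(1) order_refl])
qed

lemma nn_integral_cylinder_fun:
  assumes "cylinder_fun L h"
  shows "(\<integral>\<^sup>+ x. h x \<partial>haar m) = (\<Sum>a<M L. ennreal (1 / real (M L)) * h (pt a))"
proof -
  have "(\<integral>\<^sup>+ x. h x \<partial>haar m) = (\<integral>\<^sup>+ x. h (pt (code L x)) \<partial>haar m)"
    by (intro nn_integral_cong) (simp add: space_haar cylinder_fun_code[OF assms order_refl])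
  also have "\<dots> = (\<integral>\<^sup>+ a. h (pt a) \<partial>distr (haar m) (count_space {..<M L}) (code L))"
    by (intro nn_integral_distr[symmetric] measurable_code) simp
  also have "\<dots> = (\<Sum>a<M L. ennreal (1 / real (M L)) * h (pt a))"
    unfolding distr_code uniform_count_measure_def by (subst nn_integral_point_measure_finite) simp_all
  finally show ?thesis .
qed

lemma integral_cylinder_fun:
  fixes h :: "(nat \<Rightarrow> nat) \<Rightarrow> complex"
  assumes "cylinder_fun L h"
  shows "(\<integral>x. h x \<partial>haar m) = (\<Sum>a<M L. h (pt a)) / of_nat (M L)"
proof -
  have "(\<integral>x. h x \<partial>haar m) = (\<integral>x. h (pt (code L x)) \<partial>haar m)"
    by (intro Bochner_Integration.integral_cong refl)
      (simp add: space_haar cylinder_fun_code[OF assms order_refl])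
  also have "\<dots> = (\<integral>a. h (pt a) \<partial>distr (haar m) (count_space {..<M L}) (code L))"
    by (intro integral_distr[symmetric] measurable_code) simp
  also have "\<dots> = (\<Sum>a<M L. h (pt a)) / of_nat (M L)"
    unfolding distr_code uniform_count_measure_def
    by (subst lebesgue_integral_point_measure_finite) (simp_all add: scaleR_conv_of_real sum_divide_distrib)
  finally show ?thesis .
qed

text \<open>By induction over the generated algebra, each of its sets contains, with a point, the
  whole cylinder of that point. Applied to the level set of \<open>h\<close> through
  \<open>x\<close>, this shows that \<open>h\<close> is constant on the cylinder.\<close>

lemma cylinder_fun_measurable:
  fixes h :: "(nat \<Rightarrow> nat) \<Rightarrow> complex"
  assumes "h \<in> borel_measurable (cylinder_algebra m N)" shows "cylinder_fun N h"
proof -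
  let ?G = "vilenkin_group m"
  have sub: "cylinder m N ` ?G \<subseteq> Pow ?G" by (auto simp: cylinder_def)
  have saturated: "\<forall>x\<in>A. \<forall>y\<in>?G. (\<forall>j<N. x j = y j) \<longrightarrow> y \<in> A"
    if "A \<in> sigma_sets ?G (cylinder m N ` ?G)" for A
    using that
  proof (induction rule: sigma_sets.induct)
    case (Basic A)
    then show ?case by (auto simp: cylinder_def)
  next
    case (Compl A)
    show ?case
    proof (intro ballI impI)
      fix x y assume *: "x \<in> ?G - A" "y \<in> ?G" "\<forall>j<N. x j = y j"
      have "x \<in> A" if "y \<in> A"
      proof -
        have "(\<forall>j<N. y j = x j) \<longrightarrow> x \<in> A" using Compl.IH that *(1) by blast
        with *(3) show ?thesis by simp
      qed
      with * show "y \<in> ?G - A" by blast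
    qed
  qed blast+
  have "h x = h y" if x: "x \<in> ?G" and y: "y \<in> ?G" and eq: "\<forall>j<N. x j = y j" for x y
  proof -
    have "h -` {h x} \<inter> space (cylinder_algebra m N) \<in> sets (cylinder_algebra m N)"
      by (rule measurable_sets[OF assms]) simp
    then have "h -` {h x} \<inter> ?G \<in> sigma_sets ?G (cylinder m N ` ?G)"
      unfolding cylinder_algebra_def using sub by (simp add: space_measure_of sets_measure_of)
    moreover have "x \<in> h -` {h x} \<inter> ?G" using x by simp
    ultimately have "y \<in> h -` {h x} \<inter> ?G" using saturated y eq by blast
    then show ?thesis by simp
  qed
  then show ?thesis unfolding cylinder_fun_def by blast
qed

lemma cylinder_fun_psi: "i < M L \<Longrightarrow> cylinder_fun L (psi i)"
  unfolding cylinder_fun_def by (intro ballI impI psi_cong[of i L]) simp_all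

subsection \<open>Martingales in the finite model\<close>

text \<open>On a common class all characters involved agree, so each term is 1; otherwise the sum is
  a full block beyond a differing digit. Hence partial sums of order \<open>M N\<close> are
  conditional expectations.\<close>

lemma dirichlet_M:
  "dirichlet (pt a) (pt t) (M N) = (if t mod M N = a mod M N then of_nat (M N) else 0)"
proof (cases "t mod M N = a mod M N")
  case True
  then have "psi i (pt t) = psi i (pt a)" if "i < M N" for i
    using that by (intro psi_cong) (auto simp: mod_eq_iff_digits)
  then have "psi2 i (pt a) (pt t) = 1" if "i < M N" for i
    using that by (simp add: psi2_def complex_norm_square[symmetric])
  then show ?thesis using True by (simp add: dirichlet_def)
next
  case False
  then obtain k where "k < N" "digit m t k \<noteq> digit m a k" by (auto simp: mod_eq_iff_digits)
  then show ?thesis using False dirichlet_block_eq_0[of "pt a" "pt t" k N 1] by simp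
qed

lemma fourier_coeff_cylinder_fun:
  assumes "cylinder_fun L g" "i < M L"
  shows "fourier_coeff m g i = (\<Sum>t<M L. g (pt t) * cnj (psi i (pt t))) / of_nat (M L)"
proof -
  have "cylinder_fun L (\<lambda>x. g x * cnj (psi i x))"
    unfolding cylinder_fun_def
  proof (intro ballI impI)
    fix x y assume *: "x \<in> vilenkin_group m" "y \<in> vilenkin_group m" "\<forall>j<L. x j = y j"
    then have "g x = g y" "psi i x = psi i y"
      using assms(1) cylinder_fun_psi[OF assms(2)] unfolding cylinder_fun_def by blast+
    then show "g x * cnj (psi i x) = g y * cnj (psi i y)" by simp
  qed
  then show ?thesis unfolding fourier_coeff_def by (rule integral_cylinder_fun)
qed

lemma partial_sum_cylinder_fun:
  assumes "cylinder_fun L g" "n \<le> M L"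
  shows "partial_sum m n g x = (\<Sum>t<M L. g (pt t) * dirichlet x (pt t) n) / of_nat (M L)"
proof -
  have "partial_sum m n g x = (\<Sum>k<n. (\<Sum>t<M L. g (pt t) * cnj (psi k (pt t))) / of_nat (M L) * psi k x)"
    unfolding partial_sum_def using assms
    by (intro sum.cong refl arg_cong2[where f = "(*)"] fourier_coeff_cylinder_fun) auto
  also have "\<dots> = (\<Sum>k<n. \<Sum>t<M L. g (pt t) * psi2 k x (pt t)) / of_nat (M L)"
    unfolding sum_divide_distrib sum_distrib_right by (simp add: psi2_def mult_ac)
  also have "\<dots> = (\<Sum>t<M L. g (pt t) * dirichlet x (pt t) n) / of_nat (M L)"
    unfolding dirichlet_def sum_distrib_left by (subst sum.swap) (rule refl)
  finally show ?thesis .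
qed

context
  fixes f :: "nat \<Rightarrow> (nat \<Rightarrow> nat) \<Rightarrow> complex"
  assumes f: "vilenkin_martingale m f"
begin

lemma cylinder_fun_martingale: "cylinder_fun N (f N)"
  using f by (intro cylinder_fun_measurable) (simp add: vilenkin_martingale_def)

lemma martingale_eq_avg:
  assumes "N \<le> L" shows "f N (pt a) = avg L (\<lambda>t. f L (pt t)) N a"
proof -
  have "f N (pt a) = partial_sum m (M N) (f L) (pt a)"
    using f assms pt_in_group[of a] by (simp add: vilenkin_martingale_def)
  also have "\<dots> = (\<Sum>t<M L. f L (pt t) * dirichlet (pt a) (pt t) (M N)) / of_nat (M L)"
    using assms by (intro partial_sum_cylinder_fun cylinder_fun_martingale M_mono)
  also have "(\<Sum>t<M L. f L (pt t) * dirichlet (pt a) (pt t) (M N)) = (\<Sum>t\<in>cls L N a. f L (pt t) * of_nat (M N))"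
    by (intro sum.mono_neutral_cong_right) (auto simp: cls_def dirichlet_M)
  finally show ?thesis unfolding avg_def by (simp add: sum_distrib_right[symmetric])
qed

text \<open>The character \<open>psi i\<close> is constant on classes of level \<open>N\<close>, and
  the averages of \<open>f L\<close> over these are the values of \<open>f N\<close>. So the limit
  defining the coefficient of the martingale is eventually constant.\<close>

lemma fourier_coeff_martingale:
  assumes "i < M N" "N \<le> L" shows "fourier_coeff m (f L) i = fourier_coeff m (f N) i"
proof -
  have "i < M L" using assms M_mono[of N L] by simp
  have "(\<Sum>t<M L. f L (pt t) * cnj (psi i (pt t))) =
      (\<Sum>c<M N. \<Sum>t\<in>{t \<in> {..<M L}. t mod M N = c}. f L (pt t) * cnj (psi i (pt t)))"
    by (rule sum.group[symmetric]) auto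
  also have "\<dots> = (\<Sum>c<M N. f N (pt c) * (of_nat (M L) / of_nat (M N)) * cnj (psi i (pt c)))"
  proof (rule sum.cong[OF refl])
    fix c assume c: "c \<in> {..<M N}"
    then have "{t \<in> {..<M L}. t mod M N = c} = cls L N c" by (auto simp: cls_def)
    then have "(\<Sum>t\<in>{t \<in> {..<M L}. t mod M N = c}. f L (pt t) * cnj (psi i (pt t))) =
        (\<Sum>t\<in>cls L N c. f L (pt t) * cnj (psi i (pt c)))"
    proof (rule sum.cong)
      fix t assume "t \<in> cls L N c"
      then have "psi i (pt t) = psi i (pt c)"
        using assms(1) by (intro psi_cong[of i N]) (auto simp: cls_def mod_eq_iff_digits)
      then show "f L (pt t) * cnj (psi i (pt t)) = f L (pt t) * cnj (psi i (pt c))" by simp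
    qed
    also have "\<dots> = (\<Sum>t\<in>cls L N c. f L (pt t)) * cnj (psi i (pt c))"
      by (simp add: sum_distrib_right)
    also have "(\<Sum>t\<in>cls L N c. f L (pt t)) = f N (pt c) * (of_nat (M L) / of_nat (M N))"
      unfolding martingale_eq_avg[OF assms(2)] avg_def by simp
    finally show "(\<Sum>t\<in>{t \<in> {..<M L}. t mod M N = c}. f L (pt t) * cnj (psi i (pt t))) =
        f N (pt c) * (of_nat (M L) / of_nat (M N)) * cnj (psi i (pt c))" .
  qed
  also have "\<dots> = of_nat (M L) * ((\<Sum>c<M N. f N (pt c) * cnj (psi i (pt c))) / of_nat (M N))"
    unfolding sum_divide_distrib sum_distrib_left by (simp add: mult_ac)
  finally show ?thesis
    unfolding fourier_coeff_cylinder_fun[OF cylinder_fun_martingale \<open>i < M L\<close>]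
      fourier_coeff_cylinder_fun[OF cylinder_fun_martingale assms(1)]
    by simp
qed

lemma martingale_fourier_coeff_eq:
  assumes "i < M N" shows "martingale_fourier_coeff m f i = fourier_coeff m (f N) i"
  unfolding martingale_fourier_coeff_def
proof (intro limI tendsto_eventually)
  show "\<forall>\<^sub>F k in sequentially. fourier_coeff m (f k) i = fourier_coeff m (f N) i"
    using eventually_ge_at_top[of N] by eventually_elim (rule fourier_coeff_martingale[OF assms])
qed

lemma martingale_partial_sum_eq:
  assumes "n \<le> M L"
  shows "martingale_partial_sum m n f x = (\<Sum>t<M L. f L (pt t) * dirichlet x (pt t) n) / of_nat (M L)"
proof -
  have "martingale_partial_sum m n f x = partial_sum m n (f L) x"
    unfolding martingale_partial_sum_def partial_sum_def
    by (rule sum.cong[OF refl]) (use assms in \<open>simp add: martingale_fourier_coeff_eq[of _ L]\<close>)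
  then show ?thesis
    using partial_sum_cylinder_fun[OF cylinder_fun_martingale assms] by simp
qed

lemma sum_martingale_partial_sum_eq:
  assumes "n \<le> M L"
  shows "(\<Sum>k=1..n. martingale_partial_sum m k f x) =
    (\<Sum>t<M L. f L (pt t) * fejer_sum x (pt t) (Suc n)) / of_nat (M L)"
proof -
  have "(\<Sum>k=1..n. martingale_partial_sum m k f x) = (\<Sum>k=1..n. (\<Sum>t<M L. f L (pt t) * dirichlet x (pt t) k) / of_nat (M L))"
    using assms by (intro sum.cong refl martingale_partial_sum_eq) auto
  also have "\<dots> = (\<Sum>t<M L. \<Sum>k=1..n. f L (pt t) * dirichlet x (pt t) k) / of_nat (M L)"
    unfolding sum_divide_distrib by (rule sum.swap)
  also have "\<dots> = (\<Sum>t<M L. f L (pt t) * fejer_sum x (pt t) (Suc n)) / of_nat (M L)"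
  proof -
    have "(\<Sum>k=1..n. dirichlet x y k) = fejer_sum x y (Suc n)" for y
    proof -
      have "{..<Suc n} = insert 0 {1..n}" by auto
      then show ?thesis unfolding fejer_sum_def by (simp add: dirichlet_def)
    qed
    then show ?thesis unfolding sum_distrib_left[symmetric] by simp
  qed
  finally show ?thesis .
qed

lemma cylinder_fun_noerlund_mean:
  assumes "n \<le> M L" shows "cylinder_fun L (noerlund_mean m q n f)"
proof -
  have *: "martingale_partial_sum m k f x = martingale_partial_sum m k f y"
    if "k \<le> n" "\<forall>j<L. x j = y j" for x y k
    unfolding martingale_partial_sum_def
  proof (rule sum.cong[OF refl])
    fix i assume "i \<in> {..<k}"
    then have "psi i x = psi i y" using that assms by (intro psi_cong[of i L]) auto
    then show "martingale_fourier_coeff m f i * psi i x = martingale_fourier_coeff m f i * psi i y"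
      by simp
  qed
  have "noerlund_mean m q n f x = noerlund_mean m q n f y" if "\<forall>j<L. x j = y j" for x y
  proof -
    have "(\<Sum>k=1..n. of_real (q (n - k)) * martingale_partial_sum m k f x) =
        (\<Sum>k=1..n. of_real (q (n - k)) * martingale_partial_sum m k f y)"
      by (rule sum.cong[OF refl], subst *[OF _ that]) simp_all
    then show ?thesis unfolding noerlund_mean_def by simp
  qed
  then show ?thesis unfolding cylinder_fun_def by blast
qed

lemma max_avg_le_martingale_max:
  assumes "x \<in> vilenkin_group m"
  shows "ennreal (max_avg L (\<lambda>t. f L (pt t)) (code L x)) \<le> martingale_max f x"
proof -
  let ?F = "\<lambda>t. f L (pt t)"
  have "max_avg L ?F (code L x) \<in> (\<lambda>N. norm (avg L ?F N (code L x))) ` {..L}"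
    unfolding max_avg_def by (rule Max_in) auto
  then obtain N where N: "N \<le> L" "max_avg L ?F (code L x) = norm (avg L ?F N (code L x))" by auto
  have "f N x = avg L ?F N (code L x)"
    using cylinder_fun_code[OF cylinder_fun_martingale N(1) assms] martingale_eq_avg[OF N(1)] by simp
  then show ?thesis
    unfolding martingale_max_def N(2) by (intro SUP_upper2[of N]) auto
qed

end

subsection \<open>The maximal operator\<close>

lemma hardy_const_nonneg: "0 \<le> hardy_const"
  using lebesgue_const_nonneg R_ge_2 by (simp add: hardy_const_def atom_const_def)

context
  fixes f :: "nat \<Rightarrow> (nat \<Rightarrow> nat) \<Rightarrow> complex" and q :: "nat \<Rightarrow> real"
  assumes f: "vilenkin_martingale m f" and q_mono: "mono q" and q_0: "0 < q 0"
begin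

lemma weight_sum_pos:
  assumes "1 \<le> n" shows "0 < weight_sum q n"
  unfolding weight_sum_def
proof (rule sum_pos)
  show "0 < q k" for k using q_0 monoD[OF q_mono, of 0 k] by simp
qed (use assms in \<open>auto simp: lessThan_empty_iff\<close>)

lemma norm_noerlund_mean_le:
  assumes n: "1 \<le> n" "n \<le> M L" and W: "0 \<le> w"
    and le: "\<And>j. 1 \<le> j \<Longrightarrow> j \<le> M L \<Longrightarrow>
      norm (\<Sum>t<M L. f L (pt t) * fejer_sum x (pt t) (Suc j)) \<le> real (M L) * w * (real j * (ln (real j + 1))\<^sup>2)"
  shows "norm (noerlund_mean m q n f x) / (ln (real n + 1))\<^sup>2 \<le> w"
proof -
  let ?B = "w * (ln (real n + 1))\<^sup>2"
  have ln_pos: "0 < (ln (real n + 1))\<^sup>2" using n by simp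
  have "norm (\<Sum>k=1..n. of_real (q (n - k)) * martingale_partial_sum m k f x) \<le> ?B * (\<Sum>k<n. q k)"
  proof (rule norm_noerlund_sum_le[OF q_mono])
    fix j assume j: "1 \<le> j" "j \<le> n"
    then have "norm (\<Sum>k=1..j. martingale_partial_sum m k f x) =
        norm (\<Sum>t<M L. f L (pt t) * fejer_sum x (pt t) (Suc j)) / real (M L)"
      using n by (subst sum_martingale_partial_sum_eq[OF f, of j L]) (auto simp: norm_divide)
    also have "\<dots> \<le> real (M L) * w * (real j * (ln (real j + 1))\<^sup>2) / real (M L)"
      using j n by (intro divide_right_mono le) auto
    also have "\<dots> = real j * (w * (ln (real j + 1))\<^sup>2)" by simp
    \<comment> \<open>The weight increases with the index, so the weight at \<open>n\<close> serves
      for all Fejer means of order \<open>j \<le> n\<close>.\<close>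
    also have "\<dots> \<le> real j * ?B"
      using j W by (intro mult_left_mono power_mono) auto
    finally show "norm (\<Sum>k=1..j. martingale_partial_sum m k f x) \<le> real j * ?B" .
  qed (use W q_0 in auto)
  moreover have "norm (noerlund_mean m q n f x) =
      norm (\<Sum>k=1..n. of_real (q (n - k)) * martingale_partial_sum m k f x) / weight_sum q n"
    using weight_sum_pos[OF n(1)] by (simp add: noerlund_mean_def norm_divide)
  ultimately have "norm (noerlund_mean m q n f x) \<le> ?B"
    using weight_sum_pos[OF n(1)] by (simp add: weight_sum_def pos_divide_le_eq)
  then show ?thesis using ln_pos by (simp add: pos_divide_le_eq)
qed

text \<open>For these indices the means depend only on the first \<open>L\<close> coordinates, so
  the finite model of level \<open>L\<close> applies.\<close>

definition truncated_max :: "nat \<Rightarrow> (nat \<Rightarrow> nat) \<Rightarrow> ennreal" where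
  "truncated_max L x = (SUP n\<in>{1..M L}. ennreal (norm (noerlund_mean m q n f x) / (ln (real n + 1))\<^sup>2))"

lemma log_maximal_noerlund_le: "log_maximal_noerlund m q f x \<le> (SUP L. truncated_max L x)"
  unfolding log_maximal_noerlund_def
proof (rule SUP_least)
  fix n :: nat assume "n \<in> {1..}"
  moreover have "n < M n" by (rule less_gen_power[OF m_ge_2])
  ultimately show "ennreal (norm (noerlund_mean m q n f x) / (ln (real n + 1))\<^sup>2) \<le> (SUP L. truncated_max L x)"
    unfolding truncated_max_def by (intro SUP_upper2[of n UNIV] SUP_upper2[of n "{1..M n}"]) auto
qed

lemma incseq_truncated_max: "incseq truncated_max"
  unfolding truncated_max_def by (intro monoI le_funI SUP_subset_mono) (auto dest: M_mono)

lemma cylinder_fun_truncated_max: "cylinder_fun L (\<lambda>x. ennreal_powr (truncated_max L x) (1 / 2))"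
  unfolding cylinder_fun_def
proof (intro ballI impI)
  fix x y assume *: "x \<in> vilenkin_group m" "y \<in> vilenkin_group m" "\<forall>j<L. x j = y j"
  have "truncated_max L x = truncated_max L y"
    unfolding truncated_max_def
  proof (rule SUP_cong[OF refl])
    fix n assume "n \<in> {1..M L}"
    then have "noerlund_mean m q n f x = noerlund_mean m q n f y"
      using cylinder_fun_noerlund_mean[OF f, of n L q] * unfolding cylinder_fun_def atLeastAtMost_iff by blast
    then show "ennreal (norm (noerlund_mean m q n f x) / (ln (real n + 1))\<^sup>2) =
      ennreal (norm (noerlund_mean m q n f y) / (ln (real n + 1))\<^sup>2)" by simp
  qed
  then show "ennreal_powr (truncated_max L x) (1 / 2) = ennreal_powr (truncated_max L y) (1 / 2)"
    by simp
qed

lemma nn_integral_truncated_max_le: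
  "(\<integral>\<^sup>+ x. ennreal_powr (truncated_max L x) (1 / 2) \<partial>haar m) \<le>
    ennreal hardy_const * (\<integral>\<^sup>+ x. ennreal_powr (martingale_max f x) (1 / 2) \<partial>haar m)"
proof (rule exists_majorant[of L "\<lambda>t. f L (pt t)"])
  fix W
  let ?mx = "max_avg L (\<lambda>t. f L (pt t))"
  let ?c = "1 / real (M L)"
  assume W: "\<And>a. 0 \<le> W a"
    and le: "\<And>n a. 1 \<le> n \<Longrightarrow> n \<le> M L \<Longrightarrow>
      norm (\<Sum>t<M L. f L (pt t) * fejer_sum (pt a) (pt t) (Suc n)) \<le>
        real (M L) * W a * (real n * (ln (real n + 1))\<^sup>2)"
    and sum: "(\<Sum>a<M L. sqrt (W a)) \<le> hardy_const * (\<Sum>a<M L. sqrt (?mx a))"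
  have nonneg: "0 \<le> sqrt (?mx a)" for a by (simp add: max_avg_nonneg)
  have max_le: "ennreal_powr (truncated_max L (pt a)) (1 / 2) \<le> ennreal (sqrt (W a))" for a
  proof -
    have "truncated_max L (pt a) \<le> ennreal (W a)"
      unfolding truncated_max_def
      by (intro SUP_least ennreal_leI norm_noerlund_mean_le[of _ L] W le) auto
    then have "ennreal_powr (truncated_max L (pt a)) (1 / 2) \<le> ennreal_powr (ennreal (W a)) (1 / 2)"
      by (rule ennreal_powr_mono) simp
    then show ?thesis using ennreal_powr_half[OF W] by simp
  qed
  have "(\<integral>\<^sup>+ x. ennreal_powr (truncated_max L x) (1 / 2) \<partial>haar m) =
      (\<Sum>a<M L. ennreal ?c * ennreal_powr (truncated_max L (pt a)) (1 / 2))"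
    by (rule nn_integral_cylinder_fun[OF cylinder_fun_truncated_max])
  also have "\<dots> \<le> (\<Sum>a<M L. ennreal ?c * ennreal (sqrt (W a)))"
    by (intro sum_mono mult_left_mono max_le) simp
  also have "\<dots> = ennreal (\<Sum>a<M L. ?c * sqrt (W a))"
  proof -
    have "ennreal ?c * ennreal (sqrt (W a)) = ennreal (?c * sqrt (W a))" for a
      using W by (intro ennreal_mult[symmetric]) auto
    then show ?thesis using W by (simp only:) (intro sum_ennreal, simp)
  qed
  also have "\<dots> \<le> ennreal (\<Sum>a<M L. hardy_const * (?c * sqrt (?mx a)))"
  proof (rule ennreal_leI)
    have "(\<Sum>a<M L. ?c * sqrt (W a)) = ?c * (\<Sum>a<M L. sqrt (W a))"
      by (simp only: sum_distrib_left)
    also have "\<dots> \<le> ?c * (hardy_const * (\<Sum>a<M L. sqrt (?mx a)))"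
      by (rule mult_left_mono[OF sum]) simp
    also have "\<dots> = (\<Sum>a<M L. hardy_const * (?c * sqrt (?mx a)))"
      unfolding sum_distrib_left by (simp only: mult.left_commute)
    finally show "(\<Sum>a<M L. ?c * sqrt (W a)) \<le> (\<Sum>a<M L. hardy_const * (?c * sqrt (?mx a)))" .
  qed
  also have "\<dots> = ennreal hardy_const * (\<Sum>a<M L. ennreal ?c * ennreal (sqrt (?mx a)))"
  proof -
    have "ennreal hardy_const * (ennreal ?c * ennreal (sqrt (?mx a))) = ennreal (hardy_const * (?c * sqrt (?mx a)))" for a
    proof -
      have "0 \<le> ?c * sqrt (?mx a)" using nonneg[of a] by (intro mult_nonneg_nonneg) auto
      then show ?thesis
        using nonneg[of a] hardy_const_nonneg by (simp only: ennreal_mult of_nat_0_le_iff zero_le_divide_1_iff)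
    qed
    then show ?thesis
      unfolding sum_distrib_left
      using nonneg hardy_const_nonneg by (simp only:) (intro sum_ennreal[symmetric], simp)
  qed
  also have "(\<Sum>a<M L. ennreal ?c * ennreal (sqrt (?mx a))) = (\<integral>\<^sup>+ x. ennreal (sqrt (?mx (code L x))) \<partial>haar m)"
  proof -
    have code: "code L (pt a) = a" if "a < M L" for a
      using code_eq_iff[OF pt_in_group that, of a] by simp
    have "cylinder_fun L (\<lambda>x. ennreal (sqrt (?mx (code L x))))"
      unfolding cylinder_fun_def
    proof (intro ballI impI)
      fix x y :: "nat \<Rightarrow> nat" assume "\<forall>j<L. x j = y j"
      then have "code L x = code L y"
        unfolding code_def by (intro sum.cong refl) simp
      then show "ennreal (sqrt (?mx (code L x))) = ennreal (sqrt (?mx (code L y)))" by simp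
    qed
    then have "(\<integral>\<^sup>+ x. ennreal (sqrt (?mx (code L x))) \<partial>haar m) =
        (\<Sum>a<M L. ennreal ?c * ennreal (sqrt (?mx (code L (pt a)))))"
      by (rule nn_integral_cylinder_fun)
    also have "\<dots> = (\<Sum>a<M L. ennreal ?c * ennreal (sqrt (?mx a)))"
      by (rule sum.cong[OF refl]) (simp add: code)
    finally show ?thesis ..
  qed
  also have "\<dots> \<le> (\<integral>\<^sup>+ x. ennreal_powr (martingale_max f x) (1 / 2) \<partial>haar m)"
  proof (rule nn_integral_mono)
    fix x assume "x \<in> space (haar m)"
    then have "ennreal (?mx (code L x)) \<le> martingale_max f x"
      by (intro max_avg_le_martingale_max[OF f]) (simp add: space_haar)
    then have "ennreal_powr (ennreal (?mx (code L x))) (1 / 2) \<le> ennreal_powr (martingale_max f x) (1 / 2)"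
      by (rule ennreal_powr_mono) simp
    then show "ennreal (sqrt (?mx (code L x))) \<le> ennreal_powr (martingale_max f x) (1 / 2)"
      by (simp add: ennreal_powr_half max_avg_nonneg)
  qed
  finally show ?thesis by (simp add: mult_left_mono)
qed

text \<open>The bound for the truncated operators has a constant independent of \<open>L\<close>, so
  it passes to the limit by monotone convergence.\<close>

lemma nn_integral_log_maximal_noerlund_le:
  "(\<integral>\<^sup>+ x. ennreal_powr (log_maximal_noerlund m q f x) (1 / 2) \<partial>haar m) \<le>
    ennreal hardy_const * (\<integral>\<^sup>+ x. ennreal_powr (martingale_max f x) (1 / 2) \<partial>haar m)"
proof -
  let ?g = "\<lambda>L x. ennreal_powr (truncated_max L x) (1 / 2)"
  have "(\<integral>\<^sup>+ x. ennreal_powr (log_maximal_noerlund m q f x) (1 / 2) \<partial>haar m) \<le>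
      (\<integral>\<^sup>+ x. (SUP L. ?g L x) \<partial>haar m)"
  proof (rule nn_integral_mono)
    fix x
    have "ennreal_powr (log_maximal_noerlund m q f x) (1 / 2) \<le> ennreal_powr (SUP L. truncated_max L x) (1 / 2)"
      by (rule ennreal_powr_mono[OF log_maximal_noerlund_le]) simp
    also have "\<dots> \<le> (SUP L. ?g L x)" by (rule ennreal_powr_SUP_le)
    finally show "ennreal_powr (log_maximal_noerlund m q f x) (1 / 2) \<le> (SUP L. ?g L x)" .
  qed
  also have "\<dots> = (SUP L. \<integral>\<^sup>+ x. ?g L x \<partial>haar m)"
  proof (rule nn_integral_monotone_convergence_SUP)
    show "incseq ?g"
      using incseq_truncated_max by (auto simp: mono_def le_fun_def intro!: ennreal_powr_mono)
    show "?g L \<in> borel_measurable (haar m)" for L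
      by (rule measurable_cylinder_fun[OF cylinder_fun_truncated_max]) simp
  qed
  also have "\<dots> \<le> ennreal hardy_const * (\<integral>\<^sup>+ x. ennreal_powr (martingale_max f x) (1 / 2) \<partial>haar m)"
    by (intro SUP_least nn_integral_truncated_max_le)
  finally show ?thesis .
qed

end

lemma bounded_hardy_to_Lp_log_maximal_noerlund:
  assumes "mono q" "0 < q 0"
  shows "bounded_hardy_to_Lp m (1 / 2) (log_maximal_noerlund m q)"
  unfolding bounded_hardy_to_Lp_def
\<comment> \<open>The quasinorm with exponent 1/2 is the square of the integral of the root, so the
  constant is squared.\<close>
proof (intro exI[of _ "hardy_const\<^sup>2"] conjI ballI)
  fix f assume "f \<in> hardy_space m (1 / 2)"
  then have f: "vilenkin_martingale m f" and fin: "hardy_quasinorm m (1 / 2) f < \<infinity>"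
    by (auto simp: hardy_space_def)
  let ?A = "\<integral>\<^sup>+ x. ennreal_powr (log_maximal_noerlund m q f x) (1 / 2) \<partial>haar m"
  let ?B = "\<integral>\<^sup>+ x. ennreal_powr (martingale_max f x) (1 / 2) \<partial>haar m"
  have B: "?B \<noteq> \<infinity>"
    using fin by (auto simp: hardy_quasinorm_def Lp_quasinorm_def ennreal_powr_def)
  then obtain b where b: "0 \<le> b" "?B = ennreal b" by (metis ennreal_cases infinity_ennreal_def)
  have "?A \<le> ennreal hardy_const * ?B"
    by (rule nn_integral_log_maximal_noerlund_le[OF f assms])
  also have "\<dots> = ennreal (hardy_const * b)"
    using b hardy_const_nonneg by (simp add: ennreal_mult)
  finally have "ennreal_powr ?A 2 \<le> ennreal_powr (ennreal (hardy_const * b)) 2"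
    by (rule ennreal_powr_mono) simp
  also have "\<dots> = ennreal (hardy_const\<^sup>2) * ennreal_powr ?B 2"
  proof -
    have "ennreal_powr (ennreal (hardy_const * b)) 2 = ennreal (hardy_const\<^sup>2 * b\<^sup>2)"
      using b(1) hardy_const_nonneg by (subst ennreal_powr_2) (simp_all add: power_mult_distrib)
    then show ?thesis unfolding b(2) using b(1) by (simp add: ennreal_powr_2 ennreal_mult)
  qed
  finally show "Lp_quasinorm m (1 / 2) (log_maximal_noerlund m q f) \<le>
      ennreal (hardy_const\<^sup>2) * hardy_quasinorm m (1 / 2) f"
    by (simp add: Lp_quasinorm_def hardy_quasinorm_def)
qed simp

end

theorem theorem4p4:
  fixes m :: "nat \<Rightarrow> nat" and q :: "nat \<Rightarrow> real"
  assumes m_ge_2: "\<And>k. 2 \<le> m k"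
    and m_bounded: "bdd_above (range m)"
    and q_nonneg: "\<And>k. 0 \<le> q k"
    and q_0_pos: "0 < q 0"
    and Q_at_top: "filterlim (weight_sum q) at_top sequentially"
    and q_mono: "mono q"
  shows "bounded_hardy_to_Lp m (1 / 2) (log_maximal_noerlund m q)"
proof -
  obtain b where "m k \<le> b" for k
    using m_bounded by (auto simp: bdd_above_def)
  then interpret vilenkin_system m "real b"
    by unfold_locales (simp_all add: m_ge_2)
  show ?thesis
    by (rule bounded_hardy_to_Lp_log_maximal_noerlund[OF q_mono q_0_pos])
qed

end
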